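(* There is an algorithm that, given a map $\varepsilon\colon X^{\times}_{\mathrm{irr}}\to\mathcal{P}(M)$ in which each $\varepsilon(x,y)$ is given as an ordered set, correctly determines whether $\varepsilon$ is a Fitch map and, in the affirmative case, returns the least-resolved edge-labeled tree that explains $\varepsilon$; it can be implemented to run in $O(|X|^2\,|M|)$ time.
   Context: $X$ is a finite nonempty set, $M$ a finite nonempty set of colors, $X^{\times}_{\mathrm{irr}}=\{(x,y)\in X\times X: x\neq y\}$. A phylogenetic tree on $X$ is a rooted tree whose leaves (non-root vertices of degree $1$) form $X$, whose root has degree $\ge2$ and whose non-root inner vertices have degree $\ge3$; $C_T(v)$ denotes the set of leaves descending from $v$, $\mathcal{C}(T)=\{C_T(v): v\in V(T)\}$, and edges are written $(\mathrm{par}(v),v)$; $\mathrm{lca}(x,y)$ is the last common ancestor. An edge-labeled tree $(T,\lambda)$ on $X$ with $M$ is a phylogenetic tree $T$ on $X$ with $\lambda\colon E(T)\to\mathcal{P}(M)$; $e$ is an $m$-edge if $m\in\lambda(e)$. $(T,\lambda)$ explains $\varepsilon$ if for all $(x,y)\in X^{\times}_{\mathrm{irr}}$, $m\in M$: $m\in\varepsilon(x,y)$ iff the path from $\mathrm{lca}(x,y)$ to $y$ contains an $m$-edge; $\varepsilon$ is a Fitch map if some edge-labeled tree explains it. $(T',\lambda')$ is a coarse-graining of $(T,\lambda)$ if $\mathcal{C}(T')\subseteq\mathcal{C}(T)$ and for all non-root $v'\in V(T')$, non-root $v\in V(T)$ with $C_T(v)=C_{T'}(v')$: $\lambda'(\mathrm{par}_{T'}(v'),v')\subseteq\lambda(\mathrm{par}_T(v),v)$;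 it is strict if moreover $\mathcal{C}(T')\subsetneq\mathcal{C}(T)$ or one of these label inclusions is strict. An edge-labeled tree explaining $\varepsilon$ is least-resolved if no strict coarse-graining of it explains $\varepsilon$ (for a Fitch map it is unique up to isomorphism, i.e. up to mutual coarse-graining). *)

theory Defs
  imports Main
begin

section \<open>Edge-labeled phylogenetic trees\<close>

text \<open>
  The leaf \<open>x \<in> X\<close> is the vertex \<open>Leaf x\<close>; the other vertices are drawn from the infinite supply
  \<open>Inner i\<close>, so every finite tree with leaf set \<open>X\<close> occurs up to renaming of its inner vertices.
  Edges are directed away from the root, i.e. they are the pairs \<open>(par v, v)\<close>.
\<close>

datatype 'x vertex = Leaf 'x | Inner nat

record ('x, 'c) ltree =
  tverts :: "'x vertex set"
  troot :: "'x vertex"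
  tedges :: "('x vertex \<times> 'x vertex) set"
  tlabel :: "'x vertex \<times> 'x vertex \<Rightarrow> 'c set"

definition rooted_tree :: "('x, 'c) ltree \<Rightarrow> bool" where
  "rooted_tree T \<longleftrightarrow>
     finite (tverts T) \<and> troot T \<in> tverts T \<and> tedges T \<subseteq> tverts T \<times> tverts T \<and>
     (\<forall>u. (u, troot T) \<notin> tedges T) \<and>
     (\<forall>v \<in> tverts T - {troot T}. \<exists>!u. (u, v) \<in> tedges T) \<and>
     (\<forall>v \<in> tverts T. (troot T, v) \<in> (tedges T)\<^sup>*)"

definition tpar :: "('x, 'c) ltree \<Rightarrow> 'x vertex \<Rightarrow> 'x vertex" where
  "tpar T v = (THE u. (u, v) \<in> tedges T)"

definition tdegree :: "('x, 'c) ltree \<Rightarrow> 'x vertex \<Rightarrow> nat" where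
  "tdegree T v = card {e \<in> tedges T. fst e = v \<or> snd e = v}"

definition tleaves :: "('x, 'c) ltree \<Rightarrow> 'x vertex set" where
  "tleaves T = {v \<in> tverts T. v \<noteq> troot T \<and> tdegree T v = 1}"

definition phylogenetic_tree :: "'x set \<Rightarrow> ('x, 'c) ltree \<Rightarrow> bool" where
  "phylogenetic_tree X T \<longleftrightarrow>
     rooted_tree T \<and> tleaves T = Leaf ` X \<and> tdegree T (troot T) \<ge> 2 \<and>
     (\<forall>v \<in> tverts T - tleaves T - {troot T}. tdegree T v \<ge> 3)"

definition edge_labeled_tree :: "'x set \<Rightarrow> 'c set \<Rightarrow> ('x, 'c) ltree \<Rightarrow> bool" where
  "edge_labeled_tree X M T \<longleftrightarrow>
     phylogenetic_tree X T \<and> (\<forall>e \<in> tedges T. tlabel T e \<subseteq> M)"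

definition lca :: "('x, 'c) ltree \<Rightarrow> 'x vertex \<Rightarrow> 'x vertex \<Rightarrow> 'x vertex" where
  "lca T a b = (THE u. u \<in> tverts T \<and> (u, a) \<in> (tedges T)\<^sup>* \<and> (u, b) \<in> (tedges T)\<^sup>* \<and>
     (\<forall>w \<in> tverts T. (w, a) \<in> (tedges T)\<^sup>* \<and> (w, b) \<in> (tedges T)\<^sup>* \<longrightarrow> (w, u) \<in> (tedges T)\<^sup>*))"

definition tpath :: "('x, 'c) ltree \<Rightarrow> 'x vertex \<Rightarrow> 'x vertex list \<Rightarrow> 'x vertex \<Rightarrow> bool" where
  "tpath T u p v \<longleftrightarrow> p \<noteq> [] \<and> hd p = u \<and> last p = v \<and>
     (\<forall>i. Suc i < length p \<longrightarrow> (p ! i, p ! Suc i) \<in> tedges T)"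

definition explains :: "'x set \<Rightarrow> 'c set \<Rightarrow> ('x, 'c) ltree \<Rightarrow> ('x \<times> 'x \<Rightarrow> 'c set) \<Rightarrow> bool" where
  "explains X M T \<epsilon> \<longleftrightarrow>
     (\<forall>x \<in> X. \<forall>y \<in> X. x \<noteq> y \<longrightarrow> (\<forall>m \<in> M. m \<in> \<epsilon> (x, y) \<longleftrightarrow>
        (\<exists>p. tpath T (lca T (Leaf x) (Leaf y)) p (Leaf y) \<and>
             (\<exists>i. Suc i < length p \<and> m \<in> tlabel T (p ! i, p ! Suc i)))))"

definition fitch_map :: "'x set \<Rightarrow> 'c set \<Rightarrow> ('x \<times> 'x \<Rightarrow> 'c set) \<Rightarrow> bool" where
  "fitch_map X M \<epsilon> \<longleftrightarrow> (\<exists>T. edge_labeled_tree X M T \<and> explains X M T \<epsilon>)"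

definition cluster :: "('x, 'c) ltree \<Rightarrow> 'x vertex \<Rightarrow> 'x vertex set" where
  "cluster T v = {l \<in> tleaves T. (v, l) \<in> (tedges T)\<^sup>*}"

definition clusters :: "('x, 'c) ltree \<Rightarrow> 'x vertex set set" where
  "clusters T = cluster T ` tverts T"

definition coarse_graining :: "('x, 'c) ltree \<Rightarrow> ('x, 'c) ltree \<Rightarrow> bool" where
  "coarse_graining T' T \<longleftrightarrow>
     clusters T' \<subseteq> clusters T \<and>
     (\<forall>v' \<in> tverts T' - {troot T'}. \<forall>v \<in> tverts T - {troot T}.
        cluster T v = cluster T' v' \<longrightarrow> tlabel T' (tpar T' v', v') \<subseteq> tlabel T (tpar T v, v))"

definition strict_coarse_graining :: "('x, 'c) ltree \<Rightarrow> ('x, 'c) ltree \<Rightarrow> bool" where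
  "strict_coarse_graining T' T \<longleftrightarrow>
     coarse_graining T' T \<and>
     (clusters T' \<subset> clusters T \<or>
      (\<exists>v' \<in> tverts T' - {troot T'}. \<exists>v \<in> tverts T - {troot T}.
        cluster T v = cluster T' v' \<and> tlabel T' (tpar T' v', v') \<subset> tlabel T (tpar T v, v)))"

definition least_resolved ::
  "'x set \<Rightarrow> 'c set \<Rightarrow> ('x \<times> 'x \<Rightarrow> 'c set) \<Rightarrow> ('x, 'c) ltree \<Rightarrow> bool" where
  "least_resolved X M \<epsilon> T \<longleftrightarrow>
     edge_labeled_tree X M T \<and> explains X M T \<epsilon> \<and>
     \<not> (\<exists>T'. edge_labeled_tree X M T' \<and> strict_coarse_graining T' T \<and> explains X M T' \<epsilon>)"


section \<open>A unit-cost model of computation\<close>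

text \<open>
  Programs are while-programs over arrays of natural numbers with random access and finitely many indices. Scalar
  variables are arrays of dimension 0 (index list \<open>[]\<close>). Every variable or array access, constant,
  arithmetic operation, comparison, connective, assignment and branch costs one unit.

  The only arithmetic is successor and (truncated) predecessor. Hence after \<open>t\<close> steps every value
  and every index is at most \<open>t\<close> plus the largest number in the input or the program text. For the
  inputs below, a program with running time polynomial in \<open>|X|\<close> and \<open>|M|\<close> thus only handles numbers
  of \<open>O(log(|X| + |M|))\<close> bits, and its cost agrees up to a constant factor with its time on
  a random access machine with words of that length (multi-indices being flattened to addresses).
\<close>

type_synonym name = string

type_synonym store = "name \<Rightarrow> nat list \<Rightarrow> nat"

datatype exp = Const nat | Cell name "exp list" | Succ exp | Pred exp

datatype cond = Equal exp exp | Less exp exp | Neg cond | Conj cond cond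

datatype com =
    Skip
  | Assign name "exp list" exp
  | Seq com com
  | If cond com com
  | While cond com

fun exp_val :: "store \<Rightarrow> exp \<Rightarrow> nat" where
  "exp_val s (Const k) = k"
| "exp_val s (Cell a es) = s a (map (exp_val s) es)"
| "exp_val s (Succ e) = Suc (exp_val s e)"
| "exp_val s (Pred e) = exp_val s e - 1"

fun exp_cost :: "exp \<Rightarrow> nat" where
  "exp_cost (Const k) = 1"
| "exp_cost (Cell a es) = 1 + sum_list (map exp_cost es)"
| "exp_cost (Succ e) = 1 + exp_cost e"
| "exp_cost (Pred e) = 1 + exp_cost e"

fun cond_val :: "store \<Rightarrow> cond \<Rightarrow> bool" where
  "cond_val s (Equal e f) \<longleftrightarrow> exp_val s e = exp_val s f"
| "cond_val s (Less e f) \<longleftrightarrow> exp_val s e < exp_val s f"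
| "cond_val s (Neg b) \<longleftrightarrow> \<not> cond_val s b"
| "cond_val s (Conj b c) \<longleftrightarrow> cond_val s b \<and> cond_val s c"

fun cond_cost :: "cond \<Rightarrow> nat" where
  "cond_cost (Equal e f) = 1 + exp_cost e + exp_cost f"
| "cond_cost (Less e f) = 1 + exp_cost e + exp_cost f"
| "cond_cost (Neg b) = 1 + cond_cost b"
| "cond_cost (Conj b c) = 1 + cond_cost b + cond_cost c"

text \<open>\<open>exec P s t s'\<close>: started in \<open>s\<close>, the program \<open>P\<close> halts after exactly \<open>t\<close> time units in \<open>s'\<close>.\<close>

inductive exec :: "com \<Rightarrow> store \<Rightarrow> nat \<Rightarrow> store \<Rightarrow> bool" where
  Skip: "exec Skip s 1 s"
| Assign: "exec (Assign a es e) s (1 + sum_list (map exp_cost es) + exp_cost e)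
     (s(a := (s a)(map (exp_val s) es := exp_val s e)))"
| Seq: "exec c s t s' \<Longrightarrow> exec d s' t' s'' \<Longrightarrow> exec (Seq c d) s (t + t') s''"
| IfTrue: "cond_val s b \<Longrightarrow> exec c s t s' \<Longrightarrow> exec (If b c d) s (1 + cond_cost b + t) s'"
| IfFalse: "\<not> cond_val s b \<Longrightarrow> exec d s t s' \<Longrightarrow> exec (If b c d) s (1 + cond_cost b + t) s'"
| WhileFalse: "\<not> cond_val s b \<Longrightarrow> exec (While b c) s (1 + cond_cost b) s"
| WhileTrue: "cond_val s b \<Longrightarrow> exec c s t s' \<Longrightarrow> exec (While b c) s' t' s'' \<Longrightarrow>
     exec (While b c) s (1 + cond_cost b + t + t') s''"

lemma exec_deterministic:
  "exec P s t s' \<Longrightarrow> exec P s u s'' \<Longrightarrow> t = u \<and> s' = s''"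
proof (induction arbitrary: u s'' rule: exec.induct)
  case (Skip s)
  then show ?case by (auto elim: exec.cases)
next
  case (Assign a es e s)
  then show ?case by (auto elim: exec.cases)
next
  case (Seq c s t s' d t' s1)
  from Seq.prems obtain t1 t2 r
    where "u = t1 + t2" "exec c s t1 r" "exec d r t2 s''"
    by (auto elim: exec.cases)
  with Seq.IH show ?case by blast
next
  case (IfTrue s b c t s' d)
  from IfTrue.prems IfTrue.hyps(1) obtain t1
    where "u = 1 + cond_cost b + t1" "exec c s t1 s''"
    by (auto elim: exec.cases)
  with IfTrue.IH show ?case by blast
next
  case (IfFalse s b d t s' c)
  from IfFalse.prems IfFalse.hyps(1) obtain t1
    where "u = 1 + cond_cost b + t1" "exec d s t1 s''"
    by (auto elim: exec.cases)
  with IfFalse.IH show ?case by blast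
next
  case (WhileFalse s b c)
  then show ?case by (auto elim: exec.cases)
next
  case (WhileTrue s b c t s' t' s1)
  from WhileTrue.prems WhileTrue.hyps(1) obtain t1 t2 r
    where "u = 1 + cond_cost b + t1 + t2" "exec c s t1 r" "exec (While b c) r t2 s''"
    by (auto elim: exec.cases)
  with WhileTrue.IH show ?case by blast
qed


section \<open>Input and output format\<close>

text \<open>
  The elements of \<open>X\<close> and \<open>M\<close> are known to a program only through their positions in enumerations
  \<open>xs\<close> of \<open>X\<close> and \<open>ms\<close> of \<open>M\<close>. The set \<open>\<epsilon>(x, y)\<close> is given as its list of colors, ordered as in
  \<open>ms\<close>: for \<open>x = xs ! i\<close>, \<open>y = xs ! j\<close>, the cell \<open>size[i, j]\<close> holds its length and \<open>color[i, j, l]\<close>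
  its \<open>l\<close>-th entry. All other cells are \<open>0\<close>.
\<close>

definition ordered_colors ::
  "'x list \<Rightarrow> 'c list \<Rightarrow> ('x \<times> 'x \<Rightarrow> 'c set) \<Rightarrow> nat \<Rightarrow> nat \<Rightarrow> nat list" where
  "ordered_colors xs ms \<epsilon> i j = filter (\<lambda>c. ms ! c \<in> \<epsilon> (xs ! i, xs ! j)) [0..<length ms]"

definition input_store :: "'x list \<Rightarrow> 'c list \<Rightarrow> ('x \<times> 'x \<Rightarrow> 'c set) \<Rightarrow> store" where
  "input_store xs ms \<epsilon> a idx =
     (let irr = (\<lambda>i j. i < length xs \<and> j < length xs \<and> i \<noteq> j) in
      case idx of
        [] \<Rightarrow> if a = ''n_taxa'' then length xs else if a = ''n_colors'' then length ms else 0
      | [i, j] \<Rightarrow>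
          if a = ''size'' \<and> irr i j then length (ordered_colors xs ms \<epsilon> i j) else 0
      | [i, j, l] \<Rightarrow>
          if a = ''color'' \<and> irr i j \<and> l < length (ordered_colors xs ms \<epsilon> i j)
          then ordered_colors xs ms \<epsilon> i j ! l else 0
      | _ \<Rightarrow> 0)"

text \<open>
  An output tree has the vertices \<open>0, \<dots>, n_verts - 1\<close>, where \<open>i < |X|\<close> stands for the leaf
  \<open>xs ! i\<close>; the parent of a non-root vertex \<open>v\<close> is \<open>parent[v]\<close>, and the edge above \<open>v\<close>
  carries the color \<open>ms ! c\<close> iff \<open>label[v, c] = 1\<close>.
\<close>

definition output_vertex :: "'x list \<Rightarrow> nat \<Rightarrow> 'x vertex" where
  "output_vertex xs i = (if i < length xs then Leaf (xs ! i) else Inner i)"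

definition output_tree :: "'x list \<Rightarrow> 'c list \<Rightarrow> store \<Rightarrow> ('x, 'c) ltree" where
  "output_tree xs ms s =
     (let N = s ''n_verts'' []; r = s ''root'' []; vx = output_vertex xs in
      \<lparr> tverts = vx ` {..<N},
        troot = vx r,
        tedges = {(vx (s ''parent'' [v]), vx v) | v. v < N \<and> v \<noteq> r},
        tlabel = (\<lambda>(u, w). {ms ! c | c v. c < length ms \<and> v < N \<and> vx v = w \<and>
                                         s ''label'' [v, c] = 1}) \<rparr>)"

end

theory Submission
  imports Defs
begin

text \<open>
  For a color \<open>m\<close> and a taxon \<open>y\<close> let \<open>N\<^sub>m[y]\<close> consist of \<open>y\<close> and all \<open>x\<close> with \<open>m \<notin> \<epsilon>(x, y)\<close>. In a tree explaining
  \<open>\<epsilon>\<close>, the set \<open>N\<^sub>m[y]\<close> is the cluster of the highest ancestor of \<open>y\<close> that is reached from \<open>y\<close> without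
  crossing an \<open>m\<close>-edge; this ancestor is the root or lies below an \<open>m\<close>-edge. So \<open>\<epsilon>\<close> is a Fitch map
  iff (for at least two taxa) the sets \<open>N\<^sub>m[y]\<close> form a laminar family and \<open>N\<^sub>m[y'] \<subseteq> N\<^sub>m[y]\<close> whenever
  \<open>y' \<in> N\<^sub>m[y]\<close>, and the least-resolved tree has exactly these sets, the singletons and \<open>X\<close> as clusters,
  the edge above a cluster carrying the color \<open>m\<close> iff the cluster is some \<open>N\<^sub>m[y]\<close>.

  The tree is built top-down by inserting the sets \<open>N\<^sub>m[y]\<close> in order of decreasing size. Each taxon
  points to the smallest cluster found so far that contains it, and the family is laminar iff at every insertion
  all members of the inserted set point to the same cluster. No sorting is needed: scanning all
  \<open>|X| |M|\<close> sets once for every size already fits the time bound.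
\<close>

section \<open>Trees and neighbourhoods\<close>

locale finite_rooted_tree =
  fixes T :: "('x, 'c) ltree"
  assumes rooted: "rooted_tree T"
begin

abbreviation anc :: "'x vertex \<Rightarrow> 'x vertex \<Rightarrow> bool" (infix "\<sqsupseteq>" 50) where
  "u \<sqsupseteq> v \<equiv> (u, v) \<in> (tedges T)\<^sup>*"

lemma finite_verts: "finite (tverts T)"
  and root_vert: "troot T \<in> tverts T"
  and edge_verts: "(u, v) \<in> tedges T \<Longrightarrow> u \<in> tverts T \<and> v \<in> tverts T"
  and root_no_parent: "(u, troot T) \<notin> tedges T"
  and ex1_parent: "v \<in> tverts T \<Longrightarrow> v \<noteq> troot T \<Longrightarrow> \<exists>!u. (u, v) \<in> tedges T"
  and root_anc: "v \<in> tverts T \<Longrightarrow> troot T \<sqsupseteq> v"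
  using rooted unfolding rooted_tree_def by auto

lemma finite_edges: "finite (tedges T)"
  by (rule finite_subset[of _ "tverts T \<times> tverts T"]) (auto simp: finite_verts dest: edge_verts)

lemma parent_unique: "(u, v) \<in> tedges T \<Longrightarrow> (u', v) \<in> tedges T \<Longrightarrow> u = u'"
  by (metis edge_verts ex1_parent root_no_parent)

lemma tpar_eq: "(u, v) \<in> tedges T \<Longrightarrow> tpar T v = u"
  unfolding tpar_def by (blast intro: the_equality parent_unique)

lemma tpar_edge: "v \<in> tverts T \<Longrightarrow> v \<noteq> troot T \<Longrightarrow> (tpar T v, v) \<in> tedges T"
  by (metis ex1_parent tpar_eq)

lemma anc_vert: "u \<sqsupseteq> v \<Longrightarrow> v \<in> tverts T \<Longrightarrow> u \<in> tverts T"
  by (induction rule: converse_rtrancl_induct) (auto dest: edge_verts)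

lemma anc_parent: "u \<sqsupseteq> v \<Longrightarrow> u \<noteq> v \<Longrightarrow> (w, v) \<in> tedges T \<Longrightarrow> u \<sqsupseteq> w"
  by (metis parent_unique rtranclE)

lemma anc_chain:
  assumes "u \<sqsupseteq> x" "v \<sqsupseteq> x"
  shows "u \<sqsupseteq> v \<or> v \<sqsupseteq> u"
proof -
  have "single_valued ((tedges T)\<inverse>)"
    by (auto intro!: single_valuedI dest: parent_unique)
  from single_valued_confluent[OF this, of x u v] assms show ?thesis
    by (auto simp: rtrancl_converse)
qed

lemma no_cycle_vert: "v \<in> tverts T \<Longrightarrow> (v, v) \<notin> (tedges T)\<^sup>+"
proof -
  assume "v \<in> tverts T"
  then have "troot T \<sqsupseteq> v" by (rule root_anc)
  then show ?thesis
  proof (induction rule: rtrancl_induct)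
    case base
    then show ?case by (meson root_no_parent tranclD2)
  next
    case (step u v)
    then show ?case by (metis parent_unique rtrancl_into_trancl2 tranclD2)
  qed
qed

lemma acyclic_edges: "acyclic (tedges T)"
  unfolding acyclic_def by (metis edge_verts no_cycle_vert tranclD)

lemma anc_antisym: "u \<sqsupseteq> v \<Longrightarrow> v \<sqsupseteq> u \<Longrightarrow> u = v"
  using acyclic_edges unfolding acyclic_def by (metis rtranclD trancl_trans)

lemma not_anc_parent: "(u, v) \<in> tedges T \<Longrightarrow> \<not> v \<sqsupseteq> u"
  using acyclic_edges unfolding acyclic_def by (meson rtrancl_into_trancl1)

lemma ex_lowest_on_chain:
  assumes "A \<subseteq> {u. u \<sqsupseteq> x}" "A \<noteq> {}" "x \<in> tverts T"
  shows "\<exists>w\<in>A. \<forall>u\<in>A. u \<sqsupseteq> w"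
proof -
  have "A \<subseteq> tverts T" using assms anc_vert by auto
  then have "finite A" using finite_verts finite_subset by blast
  then show ?thesis using assms(2,1)
  proof (induction rule: finite_ne_induct)
    case (singleton u)
    then show ?case by auto
  next
    case (insert u A)
    then obtain w where w: "w \<in> A" "\<forall>u\<in>A. u \<sqsupseteq> w" by auto
    have "u \<sqsupseteq> w \<or> w \<sqsupseteq> u" using anc_chain[of u x w] insert.prems w(1) by auto
    then show ?case
    proof
      assume "w \<sqsupseteq> u"
      then have "\<forall>a\<in>insert u A. a \<sqsupseteq> u" using w(2) by (auto intro: rtrancl_trans)
      then show ?thesis by blast
    qed (use w in auto)
  qed
qed

lemma lca:
  assumes "x \<in> tverts T" "y \<in> tverts T"
  shows lca_anc1: "lca T x y \<sqsupseteq> x" and lca_anc2: "lca T x y \<sqsupseteq> y"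
    and lca_lowest: "w \<sqsupseteq> x \<Longrightarrow> w \<sqsupseteq> y \<Longrightarrow> w \<sqsupseteq> lca T x y"
proof -
  let ?A = "{u. u \<sqsupseteq> x \<and> u \<sqsupseteq> y}"
  let ?P = "\<lambda>u. u \<in> tverts T \<and> u \<sqsupseteq> x \<and> u \<sqsupseteq> y \<and> (\<forall>w\<in>tverts T. w \<sqsupseteq> x \<and> w \<sqsupseteq> y \<longrightarrow> w \<sqsupseteq> u)"
  have "troot T \<in> ?A" using assms root_anc by auto
  with ex_lowest_on_chain[of ?A x] assms
  obtain u where "u \<in> ?A" "\<forall>v\<in>?A. v \<sqsupseteq> u" by blast
  then have u: "?P u" using anc_vert assms by blast
  moreover have "v = u" if "?P v" for v using that u anc_antisym by blast
  ultimately have "lca T x y = u" unfolding lca_def by (rule the_equality)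
  with u show "lca T x y \<sqsupseteq> x" "lca T x y \<sqsupseteq> y"
    "w \<sqsupseteq> x \<Longrightarrow> w \<sqsupseteq> y \<Longrightarrow> w \<sqsupseteq> lca T x y"
    using anc_vert assms by auto
qed

lemma tpath_anc: "tpath T u p v \<Longrightarrow> i \<le> j \<Longrightarrow> j < length p \<Longrightarrow> p ! i \<sqsupseteq> p ! j"
proof (induction j)
  case (Suc j)
  show ?case
  proof (cases "i = Suc j")
    case False
    then have "p ! i \<sqsupseteq> p ! j" using Suc by simp
    moreover have "(p ! j, p ! Suc j) \<in> tedges T" using Suc.prems unfolding tpath_def by blast
    ultimately show ?thesis by (rule rtrancl_into_rtrancl)
  qed simp
qed simp

lemma tpath_append:
  assumes p: "tpath T u p a" and q: "tpath T b q v" and ab: "(a, b) \<in> tedges T"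
  shows "tpath T u (p @ q) v"
  unfolding tpath_def
proof (intro conjI allI impI)
  show "p @ q \<noteq> []" "hd (p @ q) = u" "last (p @ q) = v" using p q by (auto simp: tpath_def)
  fix i assume i: "Suc i < length (p @ q)"
  consider "Suc i < length p" | "Suc i = length p" | "length p \<le> i" by linarith
  then show "((p @ q) ! i, (p @ q) ! Suc i) \<in> tedges T"
  proof cases
    case 1
    then show ?thesis using p by (simp add: tpath_def nth_append)
  next
    case 2
    then have "(p @ q) ! i = a" using p by (auto simp: tpath_def nth_append last_conv_nth dest: arg_cong[of _ _ "\<lambda>k. k - 1"])
    moreover have "(p @ q) ! Suc i = b"
      using q 2 by (auto simp: tpath_def nth_append simp flip: hd_conv_nth)
    ultimately show ?thesis using ab by simp
  next
    case 3
    then have "Suc (i - length p) < length q" using i by simp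
    then show ?thesis using q 3 by (simp add: tpath_def nth_append Suc_diff_le)
  qed
qed

lemma anc_tpath: "u \<sqsupseteq> v \<Longrightarrow> \<exists>p. tpath T u p v"
proof (induction rule: rtrancl_induct)
  case base
  have "tpath T u [u] u" by (simp add: tpath_def)
  then show ?case ..
next
  case (step w v)
  then obtain p where p: "tpath T u p w" by blast
  have "tpath T u (p @ [v]) v"
    by (rule tpath_append[OF p _ step.hyps(2)]) (simp add: tpath_def)
  then show ?case ..
qed

lemma ex_path_through_edge_iff:
  "(\<exists>p. tpath T u p v \<and> (\<exists>i. Suc i < length p \<and> m \<in> tlabel T (p ! i, p ! Suc i))) \<longleftrightarrow>
   (\<exists>a b. u \<sqsupseteq> a \<and> (a, b) \<in> tedges T \<and> b \<sqsupseteq> v \<and> m \<in> tlabel T (a, b))" (is "?L \<longleftrightarrow> ?R")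
proof
  assume ?L
  then obtain p i where p: "tpath T u p v" "Suc i < length p" "m \<in> tlabel T (p ! i, p ! Suc i)"
    by blast
  have "p ! 0 \<sqsupseteq> p ! i" "p ! Suc i \<sqsupseteq> p ! (length p - 1)"
    using tpath_anc[OF p(1)] p(2) by auto
  moreover have "p ! 0 = u" "p ! (length p - 1) = v"
    using p(1) by (auto simp: tpath_def hd_conv_nth last_conv_nth)
  moreover have "(p ! i, p ! Suc i) \<in> tedges T" using p(1,2) by (simp add: tpath_def)
  ultimately show ?R using p(3) by metis
next
  assume ?R
  then obtain a b where ab: "u \<sqsupseteq> a" "(a, b) \<in> tedges T" "b \<sqsupseteq> v" "m \<in> tlabel T (a, b)" by blast
  obtain p q where p: "tpath T u p a" and q: "tpath T b q v" using anc_tpath ab by metis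
  let ?i = "length p - 1"
  have ne: "p \<noteq> []" "q \<noteq> []" "last p = a" "hd q = b" using p q by (auto simp: tpath_def)
  then have "Suc ?i < length (p @ q)" "(p @ q) ! ?i = a" "(p @ q) ! Suc ?i = b"
    by (auto simp: nth_append last_conv_nth hd_conv_nth)
  then show ?L using tpath_append[OF p q ab(2)] ab(4) by metis
qed

end

lemma explains_iff:
  assumes T: "edge_labeled_tree X M T"
  shows "explains X M T \<epsilon> \<longleftrightarrow>
    (\<forall>x\<in>X. \<forall>y\<in>X. x \<noteq> y \<longrightarrow> (\<forall>m\<in>M. m \<in> \<epsilon> (x, y) \<longleftrightarrow>
      (\<exists>a b. (a, b) \<in> tedges T \<and> m \<in> tlabel T (a, b) \<and>
        (b, Leaf y) \<in> (tedges T)\<^sup>* \<and> (b, Leaf x) \<notin> (tedges T)\<^sup>*)))"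
proof -
  interpret finite_rooted_tree T
    using T by unfold_locales (simp add: edge_labeled_tree_def phylogenetic_tree_def)
  have "lca T (Leaf x) (Leaf y) \<sqsupseteq> a \<longleftrightarrow> \<not> b \<sqsupseteq> Leaf x"
    if "x \<in> X" "y \<in> X" "(a, b) \<in> tedges T" "b \<sqsupseteq> Leaf y" for x y a b
  proof -
    have l: "Leaf x \<in> tverts T" "Leaf y \<in> tverts T"
      using that T by (auto simp: edge_labeled_tree_def phylogenetic_tree_def tleaves_def)
    show ?thesis
    proof
      assume "lca T (Leaf x) (Leaf y) \<sqsupseteq> a"
      then show "\<not> b \<sqsupseteq> Leaf x"
        using lca_lowest[OF l, of b] that(3,4) not_anc_parent rtrancl_trans by metis
    next
      assume b: "\<not> b \<sqsupseteq> Leaf x"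
      then have "\<not> b \<sqsupseteq> lca T (Leaf x) (Leaf y)" using lca_anc1[OF l] rtrancl_trans by metis
      then show "lca T (Leaf x) (Leaf y) \<sqsupseteq> a"
        using anc_chain[OF lca_anc2[OF l] that(4)] anc_parent that(3) by blast
    qed
  qed
  then show ?thesis unfolding explains_def ex_path_through_edge_iff by blast
qed

locale phylo_tree = finite_rooted_tree T for T :: "('x, 'c) ltree" +
  fixes X :: "'x set"
  assumes phylogenetic: "phylogenetic_tree X T"
begin

lemma leaves_eq: "tleaves T = Leaf ` X"
  using phylogenetic by (simp add: phylogenetic_tree_def)

lemma leaf_vert: "x \<in> X \<Longrightarrow> Leaf x \<in> tverts T"
  using leaves_eq by (auto simp: tleaves_def)

lemma tdegree_nonroot:
  assumes "v \<in> tverts T" "v \<noteq> troot T"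
  shows "tdegree T v = Suc (card {w. (v, w) \<in> tedges T})"
proof -
  have "{e \<in> tedges T. fst e = v \<or> snd e = v} =
    insert (tpar T v, v) (Pair v ` {w. (v, w) \<in> tedges T})"
    using assms tpar_edge tpar_eq by (auto intro: rev_image_eqI)
  moreover have "(tpar T v, v) \<notin> Pair v ` {w. (v, w) \<in> tedges T}"
    using not_anc_parent by auto
  moreover have "finite {w. (v, w) \<in> tedges T}"
    by (rule finite_subset[OF _ finite_verts]) (auto dest: edge_verts)
  ultimately show ?thesis by (simp add: tdegree_def card_image inj_on_def)
qed

lemma tdegree_root: "tdegree T (troot T) = card {w. (troot T, w) \<in> tedges T}"
proof -
  have "{e \<in> tedges T. fst e = troot T \<or> snd e = troot T} = Pair (troot T) ` {w. (troot T, w) \<in> tedges T}"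
    using root_no_parent by auto
  then show ?thesis by (simp add: tdegree_def card_image inj_on_def)
qed

lemma leaf_no_child: "v \<in> tleaves T \<Longrightarrow> (v, w) \<notin> tedges T"
proof -
  assume v: "v \<in> tleaves T"
  have "finite {w. (v, w) \<in> tedges T}"
    by (rule finite_subset[OF _ finite_verts]) (auto dest: edge_verts)
  then show ?thesis using v tdegree_nonroot[of v] by (auto simp: tleaves_def)
qed

lemma ex_other_child:
  assumes "v \<in> tverts T" "v \<notin> tleaves T"
  shows "\<exists>w'. w' \<noteq> w \<and> (v, w') \<in> tedges T"
proof (rule ccontr)
  assume "\<not> ?thesis"
  then have "{w. (v, w) \<in> tedges T} \<subseteq> {w}" by auto
  then have "card {w. (v, w) \<in> tedges T} \<le> card {w}" by (rule card_mono[rotated]) simp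
  then have "card {w. (v, w) \<in> tedges T} \<le> 1" by simp
  moreover have "v \<noteq> troot T \<Longrightarrow> 3 \<le> tdegree T v" "2 \<le> tdegree T (troot T)"
    using phylogenetic assms by (auto simp: phylogenetic_tree_def)
  ultimately show False
    using assms tdegree_nonroot[of v] tdegree_root by (cases "v = troot T") auto
qed

lemma ex_leaf_below: "v \<in> tverts T \<Longrightarrow> \<exists>l\<in>tleaves T. v \<sqsupseteq> l"
proof (induction v rule: wf_induct_rule[OF finite_acyclic_wf_converse[OF finite_edges acyclic_edges]])
  case (1 v)
  show ?case
  proof (cases "v \<in> tleaves T")
    case False
    then obtain w where "(v, w) \<in> tedges T" using ex_other_child 1(2) by blast
    then show ?thesis using 1(1)[of w] edge_verts by (auto intro: converse_rtrancl_into_rtrancl)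
  qed auto
qed

lemma cluster_inj:
  assumes "v \<in> tverts T" "w \<in> tverts T" "cluster T v = cluster T w"
  shows "v = w"
proof -
  have *: "v = w" if v: "v \<in> tverts T" "cluster T v = cluster T w" "v \<sqsupseteq> w" for v w
  proof (rule ccontr)
    assume "v \<noteq> w"
    then obtain c where c: "(v, c) \<in> tedges T" "c \<sqsupseteq> w" using v(3) by (meson converse_rtranclE)
    then have "v \<notin> tleaves T" using leaf_no_child by blast
    then obtain c' where c': "c' \<noteq> c" "(v, c') \<in> tedges T" using ex_other_child v(1) by blast
    obtain l where l: "l \<in> tleaves T" "c' \<sqsupseteq> l" using ex_leaf_below c'(2) edge_verts by blast
    then have "l \<in> cluster T v" using c'(2) by (auto simp: cluster_def intro: converse_rtrancl_into_rtrancl)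
    then have "w \<sqsupseteq> l" using v(2) by (auto simp: cluster_def)
    then have "c \<sqsupseteq> l" using c(2) by (rule rtrancl_trans[rotated])
    then have "c \<sqsupseteq> c' \<or> c' \<sqsupseteq> c" using l(2) by (rule anc_chain)
    then show False using c(1) c' anc_parent not_anc_parent by metis
  qed
  obtain l where "l \<in> tleaves T" "v \<sqsupseteq> l" using ex_leaf_below assms(1) by blast
  then have "v \<sqsupseteq> l" "w \<sqsupseteq> l" using assms(3) by (auto simp: cluster_def)
  then show ?thesis using anc_chain[of v l w] *[of v w] *[of w v] assms by auto
qed

lemma cluster_leaf: "x \<in> X \<Longrightarrow> cluster T (Leaf x) = {Leaf x}"
  using leaf_no_child[of "Leaf x"] leaves_eq by (auto simp: cluster_def elim: converse_rtranclE)

lemma cluster_root: "cluster T (troot T) = Leaf ` X"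
  using leaves_eq root_anc by (auto simp: cluster_def tleaves_def)

lemma cluster_mono: "u \<sqsupseteq> v \<Longrightarrow> cluster T v \<subseteq> cluster T u"
  by (auto simp: cluster_def intro: rtrancl_trans)

lemma clusters_laminar: "cluster T u \<subseteq> cluster T v \<or> cluster T v \<subseteq> cluster T u \<or> cluster T u \<inter> cluster T v = {}"
proof (cases "cluster T u \<inter> cluster T v = {}")
  case False
  then obtain l where "u \<sqsupseteq> l" "v \<sqsupseteq> l" by (auto simp: cluster_def)
  then have "u \<sqsupseteq> v \<or> v \<sqsupseteq> u" by (rule anc_chain)
  then show ?thesis using cluster_mono by blast
qed simp

end

definition nbh :: "'x set \<Rightarrow> ('x \<times> 'x \<Rightarrow> 'c set) \<Rightarrow> 'c \<Rightarrow> 'x \<Rightarrow> 'x set" where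
  "nbh X \<epsilon> m y = {x \<in> X. x = y \<or> m \<notin> \<epsilon> (x, y)}"

locale explaining_tree = phylo_tree T X for T :: "('x, 'c) ltree" and X +
  fixes M :: "'c set" and \<epsilon> :: "'x \<times> 'x \<Rightarrow> 'c set"
  assumes labeled: "edge_labeled_tree X M T" and explains: "explains X M T \<epsilon>"
begin

lemma mem_nbh_iff:
  assumes "x \<in> X" "y \<in> X" "m \<in> M"
  shows "x \<in> nbh X \<epsilon> m y \<longleftrightarrow>
    (\<forall>a b. (a, b) \<in> tedges T \<and> m \<in> tlabel T (a, b) \<and> b \<sqsupseteq> Leaf y \<longrightarrow> b \<sqsupseteq> Leaf x)"
proof (cases "x = y")
  case False
  with explains assms show ?thesis unfolding explains_iff[OF labeled] nbh_def by blast
qed (use assms in \<open>auto simp: nbh_def\<close>)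

lemma nbh_cluster:
  assumes y: "y \<in> X" and m: "m \<in> M"
  obtains w where "w \<in> tverts T" "w \<sqsupseteq> Leaf y" "cluster T w = Leaf ` nbh X \<epsilon> m y"
    "w = troot T \<or> m \<in> tlabel T (tpar T w, w)"
proof -
  let ?B = "insert (troot T) {b. \<exists>a. (a, b) \<in> tedges T \<and> m \<in> tlabel T (a, b) \<and> b \<sqsupseteq> Leaf y}"
  have "?B \<subseteq> {u. u \<sqsupseteq> Leaf y}" using root_anc leaf_vert y by auto
  then obtain w where w: "w \<in> ?B" "\<forall>u\<in>?B. u \<sqsupseteq> w" "w \<sqsupseteq> Leaf y"
    using ex_lowest_on_chain[of ?B "Leaf y"] leaf_vert y by blast
  have "w \<sqsupseteq> Leaf x \<longleftrightarrow> x \<in> nbh X \<epsilon> m y" if "x \<in> X" for x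
  proof
    assume "w \<sqsupseteq> Leaf x"
    then have "\<forall>u\<in>?B. u \<sqsupseteq> Leaf x" using w(2) by (blast intro: rtrancl_trans)
    then show "x \<in> nbh X \<epsilon> m y" unfolding mem_nbh_iff[OF that y m] by blast
  next
    assume "x \<in> nbh X \<epsilon> m y"
    then show "w \<sqsupseteq> Leaf x" using w(1) root_anc leaf_vert that unfolding mem_nbh_iff[OF that y m] by blast
  qed
  then have "cluster T w = Leaf ` nbh X \<epsilon> m y"
    by (auto simp: cluster_def leaves_eq) (auto simp: nbh_def)
  moreover have "w = troot T \<or> m \<in> tlabel T (tpar T w, w)" using w(1) tpar_eq by auto
  moreover have "w \<in> tverts T" using w(3) anc_vert leaf_vert y by blast
  ultimately show thesis using that w(3) by blast
qed

lemma nbh_laminar: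
  assumes "y \<in> X" "m \<in> M" "y' \<in> X" "m' \<in> M"
  shows "nbh X \<epsilon> m y \<subseteq> nbh X \<epsilon> m' y' \<or> nbh X \<epsilon> m' y' \<subseteq> nbh X \<epsilon> m y \<or>
    nbh X \<epsilon> m y \<inter> nbh X \<epsilon> m' y' = {}"
proof -
  obtain w where "cluster T w = Leaf ` nbh X \<epsilon> m y" using nbh_cluster assms by metis
  moreover obtain w' where "cluster T w' = Leaf ` nbh X \<epsilon> m' y'" using nbh_cluster assms by metis
  moreover have "inj (Leaf :: 'x \<Rightarrow> 'x vertex)" by (simp add: inj_def)
  ultimately show ?thesis using clusters_laminar[of w w']
    by (simp add: inj_image_subset_iff image_Int[symmetric])
qed

lemma nbh_subset:
  assumes "y \<in> X" "m \<in> M" "y' \<in> nbh X \<epsilon> m y"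
  shows "nbh X \<epsilon> m y' \<subseteq> nbh X \<epsilon> m y"
proof
  fix x assume x: "x \<in> nbh X \<epsilon> m y'"
  have "x \<in> X" "y' \<in> X" using x assms by (auto simp: nbh_def)
  then show "x \<in> nbh X \<epsilon> m y" using x assms mem_nbh_iff by blast
qed

end

lemma explaining_treeI:
  "edge_labeled_tree X M T \<Longrightarrow> explains X M T \<epsilon> \<Longrightarrow> explaining_tree T X M \<epsilon>"
  by unfold_locales (auto simp: edge_labeled_tree_def phylogenetic_tree_def)

text \<open>
  By \<open>nbh_cluster\<close> a tree without superfluous clusters and labels is a coarse-graining of every tree
  that explains the same map.
\<close>

lemma least_resolvedI:
  assumes T: "edge_labeled_tree X M T" "explains X M T \<epsilon>"
    and clusters: "\<And>v. v \<in> tverts T \<Longrightarrow> cluster T v = Leaf ` X \<or> (\<exists>x\<in>X. cluster T v = {Leaf x}) \<or>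
        (\<exists>y\<in>X. \<exists>m\<in>M. cluster T v = Leaf ` nbh X \<epsilon> m y)"
    and labels: "\<And>v m. v \<in> tverts T \<Longrightarrow> v \<noteq> troot T \<Longrightarrow> m \<in> tlabel T (tpar T v, v) \<Longrightarrow>
        \<exists>y\<in>X. cluster T v = Leaf ` nbh X \<epsilon> m y"
  shows "least_resolved X M \<epsilon> T"
  unfolding least_resolved_def
proof (intro conjI notI)
  interpret S: explaining_tree T X M \<epsilon> using T by (rule explaining_treeI)
  assume "\<exists>T'. edge_labeled_tree X M T' \<and> strict_coarse_graining T' T \<and> explains X M T' \<epsilon>"
  then obtain T' where T': "edge_labeled_tree X M T'" "strict_coarse_graining T' T" "explains X M T' \<epsilon>"
    by blast
  interpret S': explaining_tree T' X M \<epsilon> using T'(1,3) by (rule explaining_treeI)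
  have "cluster T v \<in> clusters T'" if "v \<in> tverts T" for v
    using clusters[OF that]
  proof (elim disjE bexE)
    assume "cluster T v = Leaf ` X"
    then show ?thesis using S'.cluster_root S'.root_vert unfolding clusters_def by (metis imageI)
  next
    fix x assume "x \<in> X" "cluster T v = {Leaf x}"
    then show ?thesis using S'.cluster_leaf S'.leaf_vert unfolding clusters_def by (metis imageI)
  next
    fix y m assume "y \<in> X" "m \<in> M" "cluster T v = Leaf ` nbh X \<epsilon> m y"
    then show ?thesis using S'.nbh_cluster unfolding clusters_def by (metis imageI)
  qed
  then have "\<not> clusters T' \<subset> clusters T" unfolding clusters_def by blast
  then obtain v' v where v: "v' \<in> tverts T'" "v' \<noteq> troot T'" "v \<in> tverts T" "v \<noteq> troot T"
    "cluster T v = cluster T' v'" "tlabel T' (tpar T' v', v') \<subset> tlabel T (tpar T v, v)"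
    using T'(2) unfolding strict_coarse_graining_def by blast
  then obtain m where m: "m \<in> tlabel T (tpar T v, v)" "m \<notin> tlabel T' (tpar T' v', v')" by blast
  have mM: "m \<in> M" using m(1) T(1) S.tpar_edge v by (auto simp: edge_labeled_tree_def)
  obtain y where y: "y \<in> X" "cluster T v = Leaf ` nbh X \<epsilon> m y" using labels v m(1) by blast
  obtain w where w: "w \<in> tverts T'" "cluster T' w = Leaf ` nbh X \<epsilon> m y"
    "w = troot T' \<or> m \<in> tlabel T' (tpar T' w, w)"
    using S'.nbh_cluster y mM by metis
  then have "w = v'" using S'.cluster_inj v y by metis
  then show False using w m v by blast
qed (use T in auto)

section \<open>Trees stored in arrays\<close>

definition nbh_idx :: "'x list \<Rightarrow> 'c list \<Rightarrow> ('x \<times> 'x \<Rightarrow> 'c set) \<Rightarrow> nat \<Rightarrow> nat \<Rightarrow> nat set" where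
  "nbh_idx xs ms \<epsilon> c j = {i. i < length xs \<and> xs ! i \<in> nbh (set xs) \<epsilon> (ms ! c) (xs ! j)}"

locale cluster_store =
  fixes xs :: "'x list" and ms :: "'c list" and \<epsilon> :: "'x \<times> 'x \<Rightarrow> 'c set"
    and s :: store and clus :: "nat \<Rightarrow> nat set"
  fixes n N :: nat and par :: "nat \<Rightarrow> nat" and nb :: "nat \<Rightarrow> nat \<Rightarrow> nat set"
  defines "n \<equiv> length xs" and "N \<equiv> s ''n_verts'' []" and "par \<equiv> \<lambda>v. s ''parent'' [v]"
    and "nb \<equiv> nbh_idx xs ms \<epsilon>"
  assumes distinct_xs: "distinct xs"
    and root: "s ''root'' [] = n"
    and n_less: "n < N"
    and clus_leaf: "\<And>i. i < n \<Longrightarrow> clus i = {i}"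
    and clus_root: "clus n = {..<n}"
    and clus_sub: "\<And>v. v < N \<Longrightarrow> clus v \<subseteq> {..<n}"
    and clus_ne: "\<And>v. v < N \<Longrightarrow> clus v \<noteq> {}"
    and clus_inj: "inj_on clus {..<N}"
    and par_less: "\<And>v. v < N \<Longrightarrow> v \<noteq> n \<Longrightarrow> par v < N"
    and par_clus: "\<And>v. v < N \<Longrightarrow> v \<noteq> n \<Longrightarrow> clus v \<subset> clus (par v)"
    and par_least: "\<And>v w. v < N \<Longrightarrow> v \<noteq> n \<Longrightarrow> w < N \<Longrightarrow> clus v \<subset> clus w \<Longrightarrow> clus (par v) \<subseteq> clus w"
    and nb_trans: "\<And>c i j. c < length ms \<Longrightarrow> j < n \<Longrightarrow> i \<in> nb c j \<Longrightarrow> nb c i \<subseteq> nb c j"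
    and nb_clus: "\<And>c j. c < length ms \<Longrightarrow> j < n \<Longrightarrow> \<exists>v<N. clus v = nb c j"
    and clus_nb: "\<And>v. n < v \<Longrightarrow> v < N \<Longrightarrow> \<exists>c<length ms. \<exists>j<n. clus v = nb c j"
    and lab: "\<And>v c. v < N \<Longrightarrow> v \<noteq> n \<Longrightarrow> c < length ms \<Longrightarrow>
      s ''label'' [v, c] = 1 \<longleftrightarrow> (\<exists>j<n. clus v = nb c j)"
begin

abbreviation "T \<equiv> output_tree xs ms s"
abbreviation "vx \<equiv> output_vertex xs"

lemma tree_simps:
  "tverts T = vx ` {..<N}" "troot T = vx n"
  "tedges T = {(vx (par v), vx v) | v. v < N \<and> v \<noteq> n}"
  "tlabel T (u, w) = {ms ! c | c v. c < length ms \<and> v < N \<and> vx v = w \<and> s ''label'' [v, c] = 1}"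
  by (simp_all add: output_tree_def Let_def root N_def par_def)

lemma vx_eq_iff [simp]: "vx u = vx v \<longleftrightarrow> u = v"
  using distinct_xs by (auto simp: output_vertex_def nth_eq_iff_index_eq)

lemma vx_leaf: "i < n \<Longrightarrow> vx i = Leaf (xs ! i)"
  by (simp add: output_vertex_def n_def)

lemma edge_iff: "(vx u, vx v) \<in> tedges T \<longleftrightarrow> v < N \<and> v \<noteq> n \<and> u = par v"
  by (auto simp: tree_simps)

lemma anc_iff:
  assumes "u < N" "v < N"
  shows "(vx u, vx v) \<in> (tedges T)\<^sup>* \<longleftrightarrow> clus v \<subseteq> clus u"
proof
  have "\<exists>v<N. b = vx v \<and> clus v \<subseteq> clus u" if "(vx u, b) \<in> (tedges T)\<^sup>*" for b
    using that
  proof (induction rule: rtrancl_induct)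
    case base
    then show ?case using assms(1) by blast
  next
    case (step b b')
    then obtain w where w: "b' = vx w" "b = vx (par w)" "w < N" "w \<noteq> n"
      by (auto simp: tree_simps)
    with step.IH have "clus (par w) \<subseteq> clus u" by auto
    then show ?case using w par_clus by blast
  qed
  then show "(vx u, vx v) \<in> (tedges T)\<^sup>* \<Longrightarrow> clus v \<subseteq> clus u" by force
next
  assume "clus v \<subseteq> clus u"
  then show "(vx u, vx v) \<in> (tedges T)\<^sup>*" using assms(2)
  proof (induction "n - card (clus v)" arbitrary: v rule: less_induct)
    case (less v)
    show ?case
    proof (cases "clus v = clus u")
      case True
      then have "v = u" using clus_inj assms(1) less.prems(2) by (auto dest: inj_onD)
      then show ?thesis by simp
    next
      case False
      then have sub: "clus v \<subset> clus u" using less.prems by blast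
      then have v: "v \<noteq> n" using clus_sub[OF assms(1)] clus_root by auto
      let ?p = "par v"
      have p: "?p < N" "clus ?p \<subseteq> clus u" "clus v \<subset> clus ?p"
        using v less.prems sub assms(1) par_less par_clus par_least by auto
      have fin: "finite (clus ?p)" using clus_sub[OF p(1)] finite_subset by blast
      have "card (clus v) < card (clus ?p)" using p(3) fin by (simp add: psubset_card_mono)
      moreover have "card (clus ?p) \<le> n" using card_mono[OF _ clus_sub[OF p(1)]] by simp
      ultimately have "(vx u, vx ?p) \<in> (tedges T)\<^sup>*"
        using less.hyps[of ?p] p by simp
      moreover have "(vx ?p, vx v) \<in> tedges T" using edge_iff v less.prems by simp
      ultimately show ?thesis by (rule rtrancl_into_rtrancl)
    qed
  qed
qed

lemma rooted_tree_output: "rooted_tree T"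
  unfolding rooted_tree_def
proof (intro conjI allI ballI)
  show "finite (tverts T)" "troot T \<in> tverts T" using n_less by (auto simp: tree_simps)
  show "tedges T \<subseteq> tverts T \<times> tverts T" using par_less by (auto simp: tree_simps)
  show "(u, troot T) \<notin> tedges T" for u by (auto simp: tree_simps)
  show "\<exists>!u. (u, v) \<in> tedges T" if "v \<in> tverts T - {troot T}" for v
    using that by (auto simp: tree_simps)
  show "(troot T, v) \<in> (tedges T)\<^sup>*" if v: "v \<in> tverts T" for v
  proof -
    obtain w where "w < N" "v = vx w" using v by (auto simp: tree_simps)
    then show ?thesis using anc_iff[of n w] n_less clus_sub clus_root by (simp add: tree_simps)
  qed
qed

lemma ex_child:
  assumes v: "n \<le> v" "v < N" and x: "x \<in> clus v"
  shows "\<exists>w. w < N \<and> w \<noteq> n \<and> par w = v \<and> x \<in> clus w"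
proof -
  have xn: "x < n" using clus_sub v x by blast
  then have "(vx v, vx x) \<in> (tedges T)\<^sup>*" using anc_iff[of v x] v x n_less clus_leaf by simp
  moreover have "vx v \<noteq> vx x" using xn v by simp
  ultimately obtain b where b: "(vx v, b) \<in> tedges T" "(b, vx x) \<in> (tedges T)\<^sup>*"
    by (meson converse_rtranclE)
  then obtain w where w: "b = vx w" "w < N" "w \<noteq> n" "par w = v" by (auto simp: tree_simps)
  then have "x \<in> clus w" using b anc_iff[of w x] xn n_less clus_leaf by simp
  then show ?thesis using w by blast
qed

lemma ex_two_children:
  assumes v: "n \<le> v" "v < N"
  shows "\<exists>w w'. w \<noteq> w' \<and> {w, w'} \<subseteq> {w. w < N \<and> w \<noteq> n \<and> par w = v}"
proof -
  obtain x where x: "x \<in> clus v" using clus_ne v by blast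
  obtain w where w: "w < N" "w \<noteq> n" "par w = v" "x \<in> clus w" using ex_child v x by blast
  then have "clus w \<subset> clus v" using par_clus by blast
  then obtain y where y: "y \<in> clus v" "y \<notin> clus w" by blast
  obtain w' where w': "w' < N" "w' \<noteq> n" "par w' = v" "y \<in> clus w'" using ex_child v y by blast
  then have "w \<noteq> w'" using y by blast
  then show ?thesis using w w' by (intro exI[of _ w] exI[of _ w']) simp
qed

lemma tdegree_output:
  assumes "v < N"
  shows "tdegree T (vx v) = (if v = n then 0 else 1) + card {w. w < N \<and> w \<noteq> n \<and> par w = v}"
proof -
  let ?C = "{w. w < N \<and> w \<noteq> n \<and> par w = v}"
  let ?I = "if v = n then {} else {(vx (par v), vx v)}"
  have "{e \<in> tedges T. fst e = vx v \<or> snd e = vx v} = ?I \<union> (\<lambda>w. (vx v, vx w)) ` ?C"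
    using assms by (auto simp: tree_simps)
  moreover have "?I \<inter> (\<lambda>w. (vx v, vx w)) ` ?C = {}"
    using assms par_clus[of v] by auto
  moreover have "inj_on (\<lambda>w. (vx v, vx w)) ?C" by (auto simp: inj_on_def)
  ultimately show ?thesis
    unfolding tdegree_def by (simp add: card_Un_disjoint card_image)
qed

lemma inner_children_card: "n \<le> v \<Longrightarrow> v < N \<Longrightarrow> 2 \<le> card {w. w < N \<and> w \<noteq> n \<and> par w = v}"
proof -
  assume v: "n \<le> v" "v < N"
  obtain w w' where w: "w \<noteq> w'" "{w, w'} \<subseteq> {w. w < N \<and> w \<noteq> n \<and> par w = v}"
    using ex_two_children[OF v] by blast
  have "card {w, w'} \<le> card {w. w < N \<and> w \<noteq> n \<and> par w = v}" using w(2) by (rule card_mono[rotated]) simp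
  then show ?thesis using w(1) by simp
qed

lemma leaf_children: "v < n \<Longrightarrow> {w. w < N \<and> w \<noteq> n \<and> par w = v} = {}"
proof -
  assume v: "v < n"
  have False if "w < N" "w \<noteq> n" "par w = v" for w
    using par_clus[of w] clus_ne[of w] clus_leaf[OF v] that by auto
  then show ?thesis by blast
qed

lemma tleaves_output: "tleaves T = vx ` {..<n}"
proof -
  have "tdegree T (vx v) = 1 \<and> v \<noteq> n \<longleftrightarrow> v < n" if "v < N" for v
    using tdegree_output[OF that] leaf_children inner_children_card[of v] that
    by (cases "v < n") auto
  then have "v < N \<and> tdegree T (vx v) = 1 \<and> v \<noteq> n \<longleftrightarrow> v < n" for v
    using n_less order.strict_trans by blast
  then have "{v. v < N \<and> tdegree T (vx v) = 1 \<and> v \<noteq> n} = {..<n}" by blast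
  moreover have "tleaves T = vx ` {v. v < N \<and> tdegree T (vx v) = 1 \<and> v \<noteq> n}"
    by (auto simp: tleaves_def tree_simps)
  ultimately show ?thesis by simp
qed

lemma vx_image_leaves: "vx ` {..<n} = Leaf ` set xs"
proof -
  have "vx ` {..<n} = (\<lambda>i. Leaf (xs ! i)) ` {..<n}" by (intro image_cong) (simp_all add: vx_leaf)
  also have "\<dots> = Leaf ` ((!) xs ` {..<n})" by (simp add: image_image)
  also have "(!) xs ` {..<n} = set xs" by (auto simp: set_conv_nth n_def)
  finally show ?thesis .
qed

lemma edge_labeled_tree_output: "edge_labeled_tree (set xs) (set ms) T"
  unfolding edge_labeled_tree_def phylogenetic_tree_def
proof (intro conjI ballI)
  show "rooted_tree T" by (rule rooted_tree_output)
  show "tleaves T = Leaf ` set xs" using tleaves_output vx_image_leaves by simp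
  show "2 \<le> tdegree T (troot T)"
    using tdegree_output[OF n_less] inner_children_card[of n] n_less by (simp add: tree_simps)
  show "3 \<le> tdegree T v" if v: "v \<in> tverts T - tleaves T - {troot T}" for v
  proof -
    obtain w where w: "v = vx w" "w < N" using v by (auto simp: tree_simps)
    moreover have "n < w" using v w by (auto simp: tleaves_output tree_simps)
    ultimately show ?thesis using tdegree_output[of w] inner_children_card[of w] by simp
  qed
  show "tlabel T e \<subseteq> set ms" if "e \<in> tedges T" for e
    by (cases e) (auto simp: tree_simps)
qed

lemma label_iff:
  assumes "v < N" "v \<noteq> n" "c < length ms" "distinct ms"
  shows "ms ! c \<in> tlabel T (u, vx v) \<longleftrightarrow> (\<exists>j<n. clus v = nb c j)"
  using assms lab[OF assms(1-3)] by (auto simp: tree_simps nth_eq_iff_index_eq)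

lemma mem_nb_iff: "i < n \<Longrightarrow> j < n \<Longrightarrow> i \<in> nb c j \<longleftrightarrow> i = j \<or> ms ! c \<notin> \<epsilon> (xs ! i, xs ! j)"
  using distinct_xs by (auto simp: nb_def nbh_idx_def nbh_def n_def nth_eq_iff_index_eq)

lemma explains_output:
  assumes ms: "distinct ms"
  shows "explains (set xs) (set ms) T \<epsilon>"
  unfolding explains_iff[OF edge_labeled_tree_output]
proof (intro ballI impI)
  fix x y m assume "x \<in> set xs" "y \<in> set xs" "x \<noteq> y" "m \<in> set ms"
  then obtain i j c where ijc: "i < n" "x = xs ! i" "j < n" "y = xs ! j" "i \<noteq> j"
    "c < length ms" "m = ms ! c"
    by (auto simp: in_set_conv_nth n_def)
  have anc: "(vx v, Leaf (xs ! k)) \<in> (tedges T)\<^sup>* \<longleftrightarrow> k \<in> clus v" if "v < N" "k < n" for v k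
    using anc_iff[of v k] that n_less clus_leaf vx_leaf by auto
  show "m \<in> \<epsilon> (x, y) \<longleftrightarrow> (\<exists>a b. (a, b) \<in> tedges T \<and> m \<in> tlabel T (a, b) \<and>
      (b, Leaf y) \<in> (tedges T)\<^sup>* \<and> (b, Leaf x) \<notin> (tedges T)\<^sup>*)" (is "?L \<longleftrightarrow> ?R")
  proof
    assume ?L
    then have i: "i \<notin> nb c j" using ijc mem_nb_iff by auto
    obtain v where v: "v < N" "clus v = nb c j" using nb_clus ijc by blast
    have "v \<noteq> n" using v i clus_root ijc by auto
    then have "(vx (par v), vx v) \<in> tedges T" "m \<in> tlabel T (vx (par v), vx v)"
      using v ijc label_iff[of v c] ms edge_iff by auto
    moreover have "j \<in> clus v" using v ijc mem_nb_iff by simp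
    ultimately show ?R using anc[of v] v i ijc by metis
  next
    assume ?R
    then obtain a b where ab: "(a, b) \<in> tedges T" "m \<in> tlabel T (a, b)"
      "(b, Leaf y) \<in> (tedges T)\<^sup>*" "(b, Leaf x) \<notin> (tedges T)\<^sup>*" by blast
    then obtain v where v: "b = vx v" "v < N" "v \<noteq> n" by (auto simp: tree_simps)
    then obtain k where k: "k < n" "clus v = nb c k" using ab(2) label_iff[of v c a] ms ijc by auto
    have "j \<in> nb c k" "i \<notin> nb c k" using ab anc[of v] v ijc k by auto
    then have "i \<notin> nb c j" using nb_trans ijc k by blast
    then show ?L using ijc mem_nb_iff by blast
  qed
qed

lemma image_nb: "j < n \<Longrightarrow> vx ` nb c j = Leaf ` nbh (set xs) \<epsilon> (ms ! c) (xs ! j)"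
proof -
  have "xs ! k \<in> nbh (set xs) \<epsilon> m y \<Longrightarrow> k < n \<Longrightarrow> Leaf (xs ! k) \<in> vx ` {i. i < n \<and> xs ! i \<in> nbh (set xs) \<epsilon> m y}"
    for k m y by (rule image_eqI[of _ _ k]) (auto simp: vx_leaf)
  moreover have "x \<in> nbh (set xs) \<epsilon> m y \<Longrightarrow> \<exists>k<n. x = xs ! k" for x m y
    by (auto simp: nbh_def in_set_conv_nth n_def)
  ultimately show ?thesis by (force simp: nb_def nbh_idx_def vx_leaf simp flip: n_def)
qed

lemma cluster_output: "v < N \<Longrightarrow> cluster T (vx v) = vx ` clus v"
proof -
  assume v: "v < N"
  have "(vx v, vx i) \<in> (tedges T)\<^sup>* \<longleftrightarrow> i \<in> clus v" if "i < n" for i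
    using anc_iff[of v i] v that n_less clus_leaf by simp
  then show ?thesis using clus_sub[OF v] by (auto simp: cluster_def tleaves_output)
qed

lemma least_resolved_output:
  assumes ms: "distinct ms"
  shows "least_resolved (set xs) (set ms) \<epsilon> T"
proof (rule least_resolvedI)
  show "edge_labeled_tree (set xs) (set ms) T" by (rule edge_labeled_tree_output)
  show "explains (set xs) (set ms) T \<epsilon>" using ms by (rule explains_output)
next
  fix v assume "v \<in> tverts T"
  then obtain w where w: "v = vx w" "w < N" by (auto simp: tree_simps)
  consider "w < n" | "w = n" | "n < w" by linarith
  then show "cluster T v = Leaf ` set xs \<or> (\<exists>x\<in>set xs. cluster T v = {Leaf x}) \<or>
    (\<exists>y\<in>set xs. \<exists>m\<in>set ms. cluster T v = Leaf ` nbh (set xs) \<epsilon> m y)"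
  proof cases
    case 1
    then have "cluster T v = {Leaf (xs ! w)}" using w cluster_output[of w] by (simp add: clus_leaf vx_leaf)
    then show ?thesis using 1 n_def by auto
  next
    case 2
    then show ?thesis using w vx_image_leaves by (simp add: cluster_output clus_root)
  next
    case 3
    then obtain c j where "c < length ms" "j < n" "clus w = nb c j" using clus_nb w by blast
    then have "cluster T v = Leaf ` nbh (set xs) \<epsilon> (ms ! c) (xs ! j)" "ms ! c \<in> set ms" "xs ! j \<in> set xs"
      using w image_nb n_def by (auto simp: cluster_output)
    then show ?thesis by blast
  qed
next
  fix v m assume v: "v \<in> tverts T" "v \<noteq> troot T" "m \<in> tlabel T (tpar T v, v)"
  then obtain w where w: "v = vx w" "w < N" "w \<noteq> n" by (auto simp: tree_simps)
  then obtain c where c: "c < length ms" "m = ms ! c" using v by (auto simp: tree_simps)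
  then obtain j where "j < n" "clus w = nb c j" using v(3) w label_iff ms by auto
  then show "\<exists>y\<in>set xs. cluster T v = Leaf ` nbh (set xs) \<epsilon> m y"
    using w c image_nb n_def by (auto simp: cluster_output)
qed

end

section \<open>Running times of while-programs\<close>

fun assigned :: "com \<Rightarrow> name set" where
  "assigned Skip = {}"
| "assigned (Assign a es e) = {a}"
| "assigned (Seq c d) = assigned c \<union> assigned d"
| "assigned (If b c d) = assigned c \<union> assigned d"
| "assigned (While b c) = assigned c"

lemma exec_frame: "exec c s t s' \<Longrightarrow> a \<notin> assigned c \<Longrightarrow> s' a = s a"
  by (induction rule: exec.induct) auto

definition runs :: "com \<Rightarrow> nat \<Rightarrow> store \<Rightarrow> (store \<Rightarrow> bool) \<Rightarrow> bool" where
  "runs c t s Q \<longleftrightarrow> (\<exists>u s'. u \<le> t \<and> exec c s u s' \<and> Q s')"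

lemma runs_mono:
  assumes "runs c t s Q" "t \<le> t'"
    and "\<And>s'. Q s' \<Longrightarrow> \<forall>a. a \<notin> assigned c \<longrightarrow> s' a = s a \<Longrightarrow> Q' s'"
  shows "runs c t' s Q'"
proof -
  obtain u s' where u: "u \<le> t" "exec c s u s'" "Q s'" using assms(1) unfolding runs_def by blast
  then have "Q' s'" using assms(3) exec_frame by blast
  then show ?thesis using u assms(2) unfolding runs_def by (meson order_trans)
qed

lemma runs_Seq:
  assumes "runs c t s (\<lambda>s'. runs d t' s' Q)"
  shows "runs (Seq c d) (t + t') s Q"
proof -
  obtain u s' v s'' where uv: "u \<le> t" "exec c s u s'" "v \<le> t'" "exec d s' v s''" "Q s''"
    using assms unfolding runs_def by blast
  then have "u + v \<le> t + t'" "exec (Seq c d) s (u + v) s''" by (auto intro: exec.Seq)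
  then show ?thesis using uv(5) unfolding runs_def by blast
qed

lemma runs_If:
  assumes "cond_val s b \<Longrightarrow> runs c t s Q" "\<not> cond_val s b \<Longrightarrow> runs d t s Q"
  shows "runs (If b c d) (1 + cond_cost b + t) s Q"
proof (cases "cond_val s b")
  case True
  then obtain u s' where "u \<le> t" "exec c s u s'" "Q s'" using assms(1) unfolding runs_def by blast
  then show ?thesis using IfTrue[OF True] unfolding runs_def by (meson add_left_mono)
next
  case False
  then obtain u s' where "u \<le> t" "exec d s u s'" "Q s'" using assms(2) unfolding runs_def by blast
  then show ?thesis using IfFalse[OF False] unfolding runs_def by (meson add_left_mono)
qed

fun loop_free :: "com \<Rightarrow> bool" where
  "loop_free (Seq c d) \<longleftrightarrow> loop_free c \<and> loop_free d"
| "loop_free (If b c d) \<longleftrightarrow> loop_free c \<and> loop_free d"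
| "loop_free (While b c) \<longleftrightarrow> False"
| "loop_free _ \<longleftrightarrow> True"

primrec com_val :: "com \<Rightarrow> store \<Rightarrow> store" where
  "com_val Skip s = s"
| "com_val (Assign a es e) s = s(a := (s a)(map (exp_val s) es := exp_val s e))"
| "com_val (Seq c d) s = com_val d (com_val c s)"
| "com_val (If b c d) s = (if cond_val s b then com_val c s else com_val d s)"
| "com_val (While b c) s = s"

fun com_cost :: "com \<Rightarrow> nat" where
  "com_cost (Assign a es e) = 1 + sum_list (map exp_cost es) + exp_cost e"
| "com_cost (Seq c d) = com_cost c + com_cost d"
| "com_cost (If b c d) = 1 + cond_cost b + max (com_cost c) (com_cost d)"
| "com_cost _ = 1"

lemma runs_loop_free: "loop_free c \<Longrightarrow> com_cost c \<le> t \<Longrightarrow> Q (com_val c s) \<Longrightarrow> runs c t s Q"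
proof (induction c arbitrary: s t Q)
  case Skip
  then show ?case using exec.Skip[of s] unfolding runs_def by auto
next
  case (Assign a es e)
  then show ?case using exec.Assign[of a es e s] unfolding runs_def com_val.simps com_cost.simps by blast
next
  case (Seq c d)
  then have "runs c (com_cost c) s (\<lambda>s'. runs d (t - com_cost c) s' Q)" by simp
  from runs_Seq[OF this] show ?case using Seq.prems(2) by simp
next
  case (If b c d)
  then have "runs (com.If b c d) (1 + cond_cost b + (t - (1 + cond_cost b))) s Q"
    by (intro runs_If) auto
  then show ?case using If.prems(2) by simp
qed simp

lemma runs_Assign_Seq:
  assumes "com_cost (Assign a es e) \<le> t" "runs d t' (com_val (Assign a es e) s) Q"
  shows "runs (Seq (Assign a es e) d) (t + t') s Q"
  by (rule runs_Seq, rule runs_loop_free) (use assms in auto)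

abbreviation Var :: "name \<Rightarrow> exp" where
  "Var a \<equiv> Cell a []"

definition For :: "name \<Rightarrow> exp \<Rightarrow> com \<Rightarrow> com" where
  "For i e c = Seq (Assign i [] (Const 0)) (While (Less (Var i) e) (Seq c (Assign i [] (Succ (Var i)))))"

lemma assigned_For [simp]: "assigned (For i e c) = insert i (assigned c)"
  by (auto simp: For_def)

lemma runs_For_sum:
  assumes i: "i \<notin> assigned c" and e: "exp_cost e \<le> 3" and N: "N \<le> B" "0 < B"
    and init: "Inv 0 (s(i := (s i)([] := 0)))"
    and bound: "\<And>k s'. k \<le> N \<Longrightarrow> Inv k s' \<Longrightarrow> s' i [] = k \<Longrightarrow>
      \<forall>a. a \<notin> insert i (assigned c) \<longrightarrow> s' a = s a \<Longrightarrow> exp_val s' e = N"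
    and body: "\<And>k s'. k < N \<Longrightarrow> Inv k s' \<Longrightarrow> s' i [] = k \<Longrightarrow>
      \<forall>a. a \<notin> insert i (assigned c) \<longrightarrow> s' a = s a \<Longrightarrow>
      runs c (t k) s' (\<lambda>s''. Inv (Suc k) (s''(i := (s'' i)([] := Suc k))))"
    and final: "\<And>s'. Inv N s' \<Longrightarrow> \<forall>a. a \<notin> insert i (assigned c) \<longrightarrow> s' a = s a \<Longrightarrow> Q s'"
  shows "runs (For i e c) ((\<Sum>k<N. t k) + B * 20) s Q"
proof -
  let ?d = "Seq c (Assign i [] (Succ (Var i)))"
  let ?fr = "\<lambda>s'. \<forall>a. a \<notin> insert i (assigned c) \<longrightarrow> s' a = s a"
  have loop: "\<exists>u s''. u \<le> (\<Sum>k=k..<N. t k) + (N - k) * 9 + 6 \<and> exec (While (Less (Var i) e) ?d) s' u s'' \<and> Inv N s'' \<and> ?fr s''"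
    if "k \<le> N" "Inv k s'" "s' i [] = k" "?fr s'" for k s'
    using that
  proof (induction "N - k" arbitrary: k s')
    case 0
    then have k: "k = N" by simp
    then have "\<not> cond_val s' (Less (Var i) e)" using bound[OF 0(2-5)] 0 by simp
    then have "exec (While (Less (Var i) e) ?d) s' (1 + cond_cost (Less (Var i) e)) s'"
      by (rule WhileFalse)
    then show ?case using 0 k e by (intro exI[of _ "1 + cond_cost (Less (Var i) e)"] exI[of _ s']) simp
  next
    case (Suc d)
    then have k: "k < N" by simp
    then have cond: "cond_val s' (Less (Var i) e)" using bound[OF Suc(3-6)] Suc by simp
    obtain u r where u: "u \<le> t k" "exec c s' u r" "Inv (Suc k) (r(i := (r i)([] := Suc k)))"
      using body[OF k Suc(4-6)] unfolding runs_def by blast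
    let ?r = "r(i := (r i)([] := Suc k))"
    have r: "r i [] = k" "\<forall>a. a \<notin> insert i (assigned c) \<longrightarrow> ?r a = s a"
      using exec_frame[OF u(2)] i Suc.prems by auto
    have "exec (Assign i [] (Succ (Var i))) r 3 ?r"
      using exec.Assign[of i "[]" "Succ (Var i)" r] r by (simp add: numeral_3_eq_3)
    then have d: "exec ?d s' (u + 3) ?r" using u(2) by (rule exec.Seq[rotated])
    obtain v s'' where v: "v \<le> (\<Sum>k=Suc k..<N. t k) + (N - Suc k) * 9 + 6" "exec (While (Less (Var i) e) ?d) ?r v s''"
      "Inv N s''" "?fr s''"
    proof -
      have "d = N - Suc k" "Suc k \<le> N" "?r i [] = Suc k" using Suc(2) k by auto
      from Suc(1)[OF this(1,2) u(3) this(3) r(2)] show thesis using that by blast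
    qed
    have "N - k = Suc (N - Suc k)" "(\<Sum>k=k..<N. t k) = t k + (\<Sum>k=Suc k..<N. t k)"
      using k by (simp_all add: sum.atLeast_Suc_lessThan)
    then have "1 + cond_cost (Less (Var i) e) + (u + 3) + v \<le> (\<Sum>k=k..<N. t k) + (N - k) * 9 + 6"
      using u(1) v(1) e by simp
    with WhileTrue[OF cond d v(2)] v show ?case by blast
  qed
  let ?s = "s(i := (s i)([] := 0))"
  have "exec (Assign i [] (Const 0)) s 2 ?s"
    using exec.Assign[of i "[]" "Const 0" s] by (simp add: numeral_2_eq_2)
  moreover from loop[of 0 ?s] init obtain u s' where u: "u \<le> (\<Sum>k<N. t k) + N * 9 + 6" "exec (While (Less (Var i) e) ?d) ?s u s'"
    "Inv N s'" "?fr s'"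
    by (auto simp: atLeast0LessThan)
  ultimately have "exec (For i e c) s (2 + u) s'" unfolding For_def by (blast intro: exec.Seq)
  moreover have "2 + u \<le> (\<Sum>k<N. t k) + B * 20" using u(1) N by linarith
  ultimately show ?thesis using final u unfolding runs_def by blast
qed

lemma runs_For:
  assumes i: "i \<notin> assigned c" and e: "exp_cost e \<le> 3" and N: "N \<le> B" "0 < B"
    and init: "Inv 0 (s(i := (s i)([] := 0)))"
    and bound: "\<And>k s'. k \<le> N \<Longrightarrow> Inv k s' \<Longrightarrow> s' i [] = k \<Longrightarrow>
      \<forall>a. a \<notin> insert i (assigned c) \<longrightarrow> s' a = s a \<Longrightarrow> exp_val s' e = N"
    and body: "\<And>k s'. k < N \<Longrightarrow> Inv k s' \<Longrightarrow> s' i [] = k \<Longrightarrow>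
      \<forall>a. a \<notin> insert i (assigned c) \<longrightarrow> s' a = s a \<Longrightarrow>
      runs c t s' (\<lambda>s''. Inv (Suc k) (s''(i := (s'' i)([] := Suc k))))"
    and final: "\<And>s'. Inv N s' \<Longrightarrow> \<forall>a. a \<notin> insert i (assigned c) \<longrightarrow> s' a = s a \<Longrightarrow> Q s'"
  shows "runs (For i e c) (B * (t + 20)) s Q"
proof -
  have "runs (For i e c) ((\<Sum>k<N. t) + B * 20) s Q"
    using assms by (rule runs_For_sum)
  then show ?thesis
    by (rule runs_mono) (use N in \<open>auto simp: add_mult_distrib2\<close>)
qed

section \<open>The algorithm\<close>

definition mark_prog :: com where
  "mark_prog =
    For ''i'' (Var ''n_taxa'')
     (For ''j'' (Var ''n_taxa'')
       (For ''l'' (Cell ''size'' [Var ''i'', Var ''j''])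
         (Assign ''mark'' [Var ''i'', Var ''j'', Cell ''color'' [Var ''i'', Var ''j'', Var ''l'']] (Const 1))))"

text \<open>
  \<open>co[c, j]\<close> counts the complement of a neighbourhood, so that running through its values upwards visits the
  neighbourhoods from large to small.
\<close>

definition count_prog :: com where
  "count_prog =
    For ''c'' (Var ''n_colors'')
     (For ''j'' (Var ''n_taxa'')
       (For ''x'' (Var ''n_taxa'')
         (If (Equal (Cell ''mark'' [Var ''x'', Var ''j'', Var ''c'']) (Const 0)) Skip
           (Assign ''co'' [Var ''c'', Var ''j''] (Succ (Cell ''co'' [Var ''c'', Var ''j'']))))))"

text \<open>
  Two members of a laminar family that share a point are nested according to their sizes. Hence the
  inclusion of \<open>N\<^sub>c[x]\<close> in \<open>N\<^sub>c[j]\<close> for \<open>x \<in> N\<^sub>c[j]\<close> can be tested in constant time.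
\<close>

definition check_prog :: com where
  "check_prog = Seq (Assign ''ok'' [] (Const 1))
    (For ''c'' (Var ''n_colors'')
     (For ''j'' (Var ''n_taxa'')
       (For ''x'' (Var ''n_taxa'')
         (If (Conj (Equal (Cell ''mark'' [Var ''x'', Var ''j'', Var ''c'']) (Const 0))
               (Less (Cell ''co'' [Var ''c'', Var ''x'']) (Cell ''co'' [Var ''c'', Var ''j''])))
           (Assign ''ok'' [] (Const 0)) Skip))))"

definition init_prog :: com where
  "init_prog = Seq (Assign ''root'' [] (Var ''n_taxa''))
    (Seq (Assign ''n_verts'' [] (Succ (Var ''n_taxa'')))
      (For ''x'' (Var ''n_taxa'') (Assign ''cur'' [Var ''x''] (Var ''n_taxa''))))"

definition same_prog :: com where
  "same_prog = For ''x'' (Var ''n_taxa'')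
    (If (Conj (Equal (Cell ''mark'' [Var ''x'', Var ''j'', Var ''c'']) (Const 0))
              (Neg (Equal (Cell ''cur'' [Var ''x'']) (Var ''p''))))
       (Assign ''ok'' [] (Const 0)) Skip)"

definition new_prog :: com where
  "new_prog =
    Seq (Assign ''parent'' [Var ''n_verts''] (Var ''p''))
   (Seq (Assign ''cco'' [Var ''n_verts''] (Var ''k''))
   (Seq (Assign ''p'' [] (Var ''n_verts''))
   (Seq (Assign ''n_verts'' [] (Succ (Var ''n_verts'')))
     (For ''x'' (Var ''n_taxa'')
       (If (Equal (Cell ''mark'' [Var ''x'', Var ''j'', Var ''c'']) (Const 0))
         (Assign ''cur'' [Var ''x''] (Var ''p'')) Skip)))))"

definition insert_prog :: com where
  "insert_prog =
    Seq (Assign ''p'' [] (Cell ''cur'' [Var ''j'']))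
   (Seq same_prog
   (Seq (If (Equal (Cell ''cco'' [Var ''p'']) (Var ''k'')) Skip new_prog)
     (Assign ''label'' [Var ''p'', Var ''c''] (Const 1))))"

definition main_prog :: com where
  "main_prog =
    For ''k'' (Var ''n_taxa'')
     (For ''c'' (Var ''n_colors'')
       (For ''j'' (Var ''n_taxa'')
         (If (Conj (Equal (Cell ''co'' [Var ''c'', Var ''j'']) (Var ''k'')) (Less (Succ (Var ''k'')) (Var ''n_taxa'')))
           insert_prog Skip)))"

definition leaf_prog :: com where
  "leaf_prog =
    For ''j'' (Var ''n_taxa'')
      (Seq (Assign ''parent'' [Var ''j''] (Cell ''cur'' [Var ''j'']))
        (For ''c'' (Var ''n_colors'')
          (If (Equal (Succ (Cell ''co'' [Var ''c'', Var ''j''])) (Var ''n_taxa''))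
            (Assign ''label'' [Var ''j'', Var ''c''] (Const 1)) Skip)))"

definition fitch_prog :: com where
  "fitch_prog =
    If (Less (Const 1) (Var ''n_taxa''))
      (Seq mark_prog (Seq count_prog (Seq check_prog (Seq init_prog (Seq main_prog (Seq leaf_prog
        (Assign ''is_fitch'' [] (Var ''ok''))))))))
      Skip"

lemma runs_mark_prog:
  fixes L :: "nat \<Rightarrow> nat \<Rightarrow> nat list"
  assumes pos: "0 < n" "0 < m" and n: "s ''n_taxa'' [] = n"
    and size: "\<And>i j. i < n \<Longrightarrow> j < n \<Longrightarrow> s ''size'' [i, j] = length (L i j)"
    and len: "\<And>i j. length (L i j) \<le> m"
    and color: "\<And>i j l. i < n \<Longrightarrow> j < n \<Longrightarrow> l < length (L i j) \<Longrightarrow> s ''color'' [i, j, l] = L i j ! l"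
    and zero: "\<And>idx. s ''mark'' idx = 0"
  shows "runs mark_prog (n * (n * (m * (8 + 20) + 20) + 20)) s
    (\<lambda>s'. \<forall>i<n. \<forall>j<n. \<forall>c. s' ''mark'' [i, j, c] = of_bool (c \<in> set (L i j)))"
  unfolding mark_prog_def
proof (rule runs_For[where N = n and Inv = "\<lambda>k s'. \<forall>i j c.
    s' ''mark'' [i, j, c] = of_bool (i < k \<and> j < n \<and> c \<in> set (L i j))"], goal_cases)
  case outer: (7 i s1)
  show ?case
  proof (rule runs_For[where N = n and Inv = "\<lambda>k s'. \<forall>a b c. s' ''mark'' [a, b, c] =
      of_bool ((a < i \<and> b < n \<or> a = i \<and> b < k) \<and> c \<in> set (L a b))"], goal_cases)
    case mid: (7 j s2)
    have [simp]: "s2 ''i'' [] = i" "s2 ''size'' [i, j] = length (L i j)"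
      using mid(4) outer mid(1) size by auto
    show ?case
    proof (rule runs_For[where N = "length (L i j)" and Inv = "\<lambda>k s'. \<forall>a b c. s' ''mark'' [a, b, c] =
      of_bool ((a < i \<and> b < n \<or> a = i \<and> b < j) \<and> c \<in> set (L a b) \<or> a = i \<and> b = j \<and> c \<in> set (take k (L i j)))"], goal_cases)
      case inner: (7 l s3)
      have "s3 ''i'' [] = i" "s3 ''j'' [] = j" "s3 ''color'' [i, j, l] = L i j ! l"
        using inner(4) mid outer color inner(1) by auto
      then show ?case
        using inner mid(1,3) by (intro runs_loop_free) (auto simp: take_Suc_conv_app_nth)
    next
      case (5)
      then show ?case using mid(2) by simp
    next
      case (6 l s3)
      have "s3 ''i'' [] = s2 ''i'' []" "s3 ''j'' [] = j" "s3 ''size'' = s2 ''size''"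
        using 6(4) mid(3) by auto
      then show ?case by simp
    next
      case (8 s3)
      then show ?case using mid(1) outer(1) by (auto simp: less_Suc_eq)
    qed (simp_all add: pos len)
  qed (use outer pos n in \<open>auto simp: less_Suc_eq\<close>)
qed (use pos n zero in auto)

lemma runs_count_prog:
  fixes D :: "nat \<Rightarrow> nat \<Rightarrow> nat \<Rightarrow> bool"
  assumes pos: "0 < n" "0 < m" and n: "s ''n_taxa'' [] = n" and m: "s ''n_colors'' [] = m"
    and mark: "\<And>x j c. x < n \<Longrightarrow> j < n \<Longrightarrow> c < m \<Longrightarrow> s ''mark'' [x, j, c] = of_bool (D x j c)"
    and zero: "\<And>idx. s ''co'' idx = 0"
  shows "runs count_prog (m * (n * (n * (15 + 20) + 20) + 20)) s
    (\<lambda>s'. \<forall>c<m. \<forall>j<n. s' ''co'' [c, j] = card {x. x < n \<and> D x j c})"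
  unfolding count_prog_def
proof (rule runs_For[where N = m and Inv = "\<lambda>k s'. \<forall>c j. s' ''co'' [c, j] =
    (if c < k \<and> j < n then card {x. x < n \<and> D x j c} else 0)"], goal_cases)
  case outer: (7 c s1)
  show ?case
  proof (rule runs_For[where N = n and Inv = "\<lambda>k s'. \<forall>a b. s' ''co'' [a, b] =
      (if a < c \<and> b < n \<or> a = c \<and> b < k then card {x. x < n \<and> D x b a} else 0)"], goal_cases)
    case mid: (7 j s2)
    show ?case
    proof (rule runs_For[where N = n and Inv = "\<lambda>k s'. \<forall>a b. s' ''co'' [a, b] =
      (if a < c \<and> b < n \<or> a = c \<and> b < j then card {x. x < n \<and> D x b a}
       else if a = c \<and> b = j then card {x. x < k \<and> D x j c} else 0)"], goal_cases)
      case inner: (7 x s3)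
      have "s3 ''c'' [] = c" "s3 ''j'' [] = j" "s3 ''mark'' [x, j, c] = of_bool (D x j c)"
        using inner(4) mid outer mark inner(1) by auto
      moreover have "{y. y < Suc x \<and> D y j c} = (if D x j c then insert x else id) {y. y < x \<and> D y j c}"
        by (auto simp: less_Suc_eq)
      ultimately show ?case
        using inner mid(1,3) by (intro runs_loop_free) auto
    next
      case (8 s3)
      then show ?case using mid(1) outer(1) by (auto simp: less_Suc_eq)
    qed (use mid outer pos n in \<open>auto\<close>)
  qed (use outer pos n in \<open>auto simp: less_Suc_eq\<close>)
qed (use pos n m zero in auto)

lemma runs_check_prog:
  fixes D :: "nat \<Rightarrow> nat \<Rightarrow> nat \<Rightarrow> bool"
  assumes pos: "0 < n" "0 < m" and n: "s ''n_taxa'' [] = n" and m: "s ''n_colors'' [] = m"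
    and mark: "\<And>x j c. x < n \<Longrightarrow> j < n \<Longrightarrow> c < m \<Longrightarrow> s ''mark'' [x, j, c] = of_bool (D x j c)"
    and co: "\<And>j c. j < n \<Longrightarrow> c < m \<Longrightarrow> s ''co'' [c, j] = co c j"
  shows "runs check_prog (2 + m * (n * (n * (17 + 20) + 20) + 20)) s
    (\<lambda>s'. s' ''ok'' [] = of_bool (\<forall>c<m. \<forall>j<n. \<forall>x<n. \<not> D x j c \<longrightarrow> co c j \<le> co c x))"
  unfolding check_prog_def
proof (rule runs_Seq, rule runs_loop_free, goal_cases)
  case 3
  let ?A = "\<lambda>c j x. \<not> D x j c \<longrightarrow> co c j \<le> co c x"
  show ?case
  proof (rule runs_For[where N = m and Inv = "\<lambda>k s'. s' ''ok'' [] =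
    of_bool (\<forall>c<k. \<forall>j<n. \<forall>x<n. ?A c j x)"], goal_cases)
    case outer: (7 c s1)
    show ?case
    proof (rule runs_For[where N = n and Inv = "\<lambda>k s'. s' ''ok'' [] =
        of_bool ((\<forall>c'<c. \<forall>j<n. \<forall>x<n. ?A c' j x) \<and> (\<forall>j<k. \<forall>x<n. ?A c j x))"], goal_cases)
      case mid: (7 j s2)
      show ?case
      proof (rule runs_For[where N = n and Inv = "\<lambda>k s'. s' ''ok'' [] =
          of_bool ((\<forall>c'<c. \<forall>j<n. \<forall>x<n. ?A c' j x) \<and> (\<forall>j'<j. \<forall>x<n. ?A c j' x) \<and> (\<forall>x<k. ?A c j x))"], goal_cases)
        case inner: (7 x s3)
        have "s3 ''c'' [] = c" "s3 ''j'' [] = j" "s3 ''mark'' [x, j, c] = of_bool (D x j c)"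
          "s3 ''co'' [c, x] = co c x" "s3 ''co'' [c, j] = co c j"
          using inner(4) mid outer mark co inner(1) by auto
        then show ?case
          using inner mid(1,3) by (intro runs_loop_free) (auto simp: All_less_Suc not_le)
      next
        case (8 s3)
        then show ?case by (simp add: All_less_Suc conj_assoc)
      qed (use mid outer pos n in \<open>auto\<close>)
    qed (use outer pos n in \<open>auto simp: All_less_Suc\<close>)
  qed (use pos n m in auto)
qed auto

section \<open>Insertion of neighbourhoods\<close>

text \<open>
  The state of the tree construction once the neighbourhoods indexed by \<open>P\<close> have been inserted: \<open>clus v\<close>
  is the cluster of the vertex \<open>v\<close> (vertex \<open>n\<close> is the root, leaves are attached at the end), \<open>cur x\<close> is the
  vertex of the smallest cluster containing \<open>x\<close>, and \<open>cco v\<close> is the number of taxa outside \<open>clus v\<close>.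
\<close>

locale cluster_inv =
  fixes n :: nat and nb :: "nat \<Rightarrow> nat \<Rightarrow> nat set" and P :: "(nat \<times> nat) set" and N :: nat
    and cur par cco :: "nat \<Rightarrow> nat" and lab :: "nat \<Rightarrow> nat \<Rightarrow> nat" and clus :: "nat \<Rightarrow> nat set"
  assumes n_less: "n < N" and clus_root: "clus n = {..<n}"
    and clus_sub: "\<And>v. n \<le> v \<Longrightarrow> v < N \<Longrightarrow> clus v \<subseteq> {..<n}"
    and clus_ne: "\<And>v. n \<le> v \<Longrightarrow> v < N \<Longrightarrow> clus v \<noteq> {}"
    and cco: "\<And>v. n \<le> v \<Longrightarrow> v < N \<Longrightarrow> cco v = n - card (clus v)"
    and clus_inj: "\<And>v w. n \<le> v \<Longrightarrow> v < N \<Longrightarrow> n \<le> w \<Longrightarrow> w < N \<Longrightarrow> clus v = clus w \<Longrightarrow> v = w"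
    and laminar: "\<And>v w. n \<le> v \<Longrightarrow> v < N \<Longrightarrow> n \<le> w \<Longrightarrow> w < N \<Longrightarrow>
      clus v \<subseteq> clus w \<or> clus w \<subseteq> clus v \<or> clus v \<inter> clus w = {}"
    and clus_nb: "\<And>v. n < v \<Longrightarrow> v < N \<Longrightarrow> \<exists>c j. (c, j) \<in> P \<and> clus v = nb c j"
    and nb_clus: "\<And>c j. (c, j) \<in> P \<Longrightarrow> \<exists>v. n \<le> v \<and> v < N \<and> clus v = nb c j"
    and cur_vert: "\<And>x. x < n \<Longrightarrow> n \<le> cur x \<and> cur x < N"
    and cur_mem: "\<And>x. x < n \<Longrightarrow> x \<in> clus (cur x)"
    and cur_least: "\<And>x v. x < n \<Longrightarrow> n \<le> v \<Longrightarrow> v < N \<Longrightarrow> x \<in> clus v \<Longrightarrow> clus (cur x) \<subseteq> clus v"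
    and par_vert: "\<And>v. n < v \<Longrightarrow> v < N \<Longrightarrow> n \<le> par v \<and> par v < N"
    and par_clus: "\<And>v. n < v \<Longrightarrow> v < N \<Longrightarrow> clus v \<subset> clus (par v)"
    and par_least: "\<And>v w. n < v \<Longrightarrow> v < N \<Longrightarrow> n \<le> w \<Longrightarrow> w < N \<Longrightarrow> clus v \<subset> clus w \<Longrightarrow> clus (par v) \<subseteq> clus w"
    and lab: "\<And>v c. n \<le> v \<Longrightarrow> v < N \<Longrightarrow> lab v c = 1 \<longleftrightarrow> (\<exists>j. (c, j) \<in> P \<and> clus v = nb c j)"
    and lab_fresh: "\<And>v c. v < n \<or> N \<le> v \<Longrightarrow> lab v c = 0"
begin

context
  fixes c j
  assumes nb_sub: "nb c j \<subseteq> {..<n}" and j: "j \<in> nb c j"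
begin

lemma cur_eq_if_laminar:
  assumes lam: "\<And>a b. (a, b) \<in> P \<Longrightarrow> nb a b \<subseteq> nb c j \<or> nb c j \<subseteq> nb a b \<or> nb a b \<inter> nb c j = {}"
    and card: "\<And>a b. (a, b) \<in> P \<Longrightarrow> card (nb c j) \<le> card (nb a b)"
    and x: "x \<in> nb c j"
  shows "cur x = cur j"
proof -
  have sub: "nb c j \<subseteq> clus (cur y)" if y: "y \<in> nb c j" for y
  proof (cases "cur y = n")
    case True
    then show ?thesis using nb_sub clus_root by simp
  next
    case False
    have yn: "y < n" using y nb_sub by auto
    then obtain a b where ab: "(a, b) \<in> P" "clus (cur y) = nb a b"
      using clus_nb[of "cur y"] cur_vert[OF yn] False by (metis le_neq_implies_less)
    then have "y \<in> nb a b" using cur_mem yn by auto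
    then consider "nb c j \<subseteq> nb a b" | "nb a b \<subseteq> nb c j" using lam[OF ab(1)] y by blast
    then show ?thesis
    proof cases
      case 2
      then have "nb a b = nb c j"
        using card[OF ab(1)] nb_sub by (meson card_seteq finite_lessThan finite_subset)
      then show ?thesis using ab by simp
    qed (use ab in simp)
  qed
  have xj: "x < n" "j < n" using x j nb_sub by auto
  have "clus (cur x) \<subseteq> clus (cur j)" "clus (cur j) \<subseteq> clus (cur x)"
    using cur_least xj cur_vert sub x j by blast+
  then show ?thesis using clus_inj cur_vert xj by blast
qed

context
  assumes same: "\<And>x. x \<in> nb c j \<Longrightarrow> cur x = cur j"
begin

lemma jn: "j < n"
  using j nb_sub by auto

lemma nb_sub_cur: "nb c j \<subseteq> clus (cur j)"
proof
  fix x assume x: "x \<in> nb c j"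
  then have "x \<in> clus (cur x)" using cur_mem nb_sub by auto
  then show "x \<in> clus (cur j)" using same[OF x] by simp
qed

lemma insert_old:
  assumes cco_eq: "cco (cur j) = n - card (nb c j)"
    and lab': "\<And>v d. lab' v d = (if v = cur j \<and> d = c then 1 else lab v d)"
  shows "cluster_inv n nb (insert (c, j) P) N cur par cco lab' clus"
proof -
  let ?p = "cur j"
  have p: "n \<le> ?p" "?p < N" using cur_vert jn by auto
  have "card (nb c j) \<le> n" using card_mono[OF _ nb_sub] by simp
  moreover have "card (clus ?p) \<le> n" using card_mono[OF _ clus_sub[OF p]] by simp
  ultimately have "card (clus ?p) = card (nb c j)" using cco_eq cco[OF p] by simp
  then have eq: "clus ?p = nb c j"
    using nb_sub_cur clus_sub[OF p] by (metis card_subset_eq finite_lessThan finite_subset)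
  show ?thesis
  proof (unfold_locales, goal_cases)
    case (8 v)
    then show ?case using clus_nb by blast
  next
    case (9 a b)
    then show ?case using nb_clus eq p by blast
  next
    case (16 v d)
    show ?case
    proof (cases "v = ?p")
      case True
      then show ?thesis using lab[OF 16] lab' eq by auto
    next
      case False
      then have "clus v \<noteq> nb c j" using clus_inj[OF 16 p] eq by auto
      then show ?thesis using lab[OF 16] lab' False by auto
    qed
  next
    case (17 v d)
    then show ?case using lab' lab_fresh p by auto
  qed ((rule n_less clus_root clus_sub clus_ne cco clus_inj laminar cur_vert cur_mem cur_least
      par_vert par_clus par_least; assumption)+)
qed

lemma insert_new:
  assumes cco_ne: "cco (cur j) \<noteq> n - card (nb c j)"
    and cur': "\<And>x. cur' x = (if x \<in> nb c j then N else cur x)"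
    and par': "\<And>v. par' v = (if v = N then cur j else par v)"
    and cco': "\<And>v. cco' v = (if v = N then n - card (nb c j) else cco v)"
    and lab': "\<And>v d. lab' v d = (if v = N \<and> d = c then 1 else lab v d)"
  shows "cluster_inv n nb (insert (c, j) P) (Suc N) cur' par' cco' lab' (clus(N := nb c j))"
proof -
  let ?p = "cur j" and ?S = "nb c j" and ?clus = "clus(N := nb c j)"
  have p: "n \<le> ?p" "?p < N" using cur_vert jn by auto
  have S: "?S \<subset> clus ?p" using nb_sub_cur cco_ne cco[OF p] by auto
  have above: "clus ?p \<subseteq> clus v" if "n \<le> v" "v < N" "x \<in> ?S" "x \<in> clus v" for v x
    using cur_least[of x v] that same[of x] nb_sub by auto
  have lam: "?S \<subset> clus v \<or> ?S \<inter> clus v = {}" if "n \<le> v" "v < N" for v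
    using above[OF that] S by blast
  have ne: "clus v \<noteq> ?S" if "n \<le> v" "v < N" for v
    using lam[OF that] j by blast
  have not_sub: "\<not> clus v \<subset> ?S" if "n \<le> v" "v < N" for v
    using lam[OF that] clus_ne[OF that] by blast
  have old: "v \<noteq> N" "v < N" if "n \<le> v" "v < Suc N" "v \<noteq> N" for v using that by auto
  show ?thesis
  proof (unfold_locales, goal_cases)
    case 1
    then show ?case using n_less by simp
  next
    case 2
    then show ?case using n_less clus_root by simp
  next
    case (3 v)
    then show ?case using clus_sub[of v] nb_sub by (cases "v = N") auto
  next
    case (4 v)
    then show ?case using clus_ne[of v] j by (cases "v = N") auto
  next
    case (5 v)
    then show ?case using cco[of v] cco' by (cases "v = N") auto
  next
    case (6 v w)
    then show ?case using clus_inj[of v w] ne[of v] ne[of w] by (cases "v = N"; cases "w = N") auto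
  next
    case (7 v w)
    then show ?case using laminar[of v w] lam[of v] lam[of w] by (cases "v = N"; cases "w = N") auto
  next
    case (8 v)
    then show ?case
    proof (cases "v = N")
      case False
      with 8 clus_nb[of v] show ?thesis by auto
    qed auto
  next
    case (9 a b)
    show ?case
    proof (cases "(a, b) = (c, j)")
      case True
      then show ?thesis using n_less by (intro exI[of _ N]) auto
    next
      case False
      then obtain v where "n \<le> v" "v < N" "clus v = nb a b" using nb_clus[of a b] 9 by blast
      then show ?thesis by (intro exI[of _ v]) auto
    qed
  next
    case (10 x)
    then show ?case using cur_vert[of x] cur' n_less by auto
  next
    case (11 x)
    then show ?case using cur_mem[of x] cur_vert[of x] cur' by auto
  next
    case (12 x v)
    show ?case
    proof (cases "v = N")
      case True
      then show ?thesis using 12 cur' by simp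
    next
      case False
      then have v: "n \<le> v" "v < N" "x \<in> clus v" using 12 by auto
      show ?thesis
      proof (cases "x \<in> ?S")
        case True
        then show ?thesis using above[OF v(1,2) True v(3)] S cur' False by auto
      next
        case x: False
        then show ?thesis using cur_least[OF 12(1) v] cur_vert[OF 12(1)] cur' False by auto
      qed
    qed
  next
    case (13 v)
    then show ?case using par_vert[of v] par' p by (cases "v = N") auto
  next
    case (14 v)
    then show ?case using par_clus[of v] par_vert[of v] par' p S by (cases "v = N") auto
  next
    case (15 v w)
    consider "v = N" "w = N" | "v = N" "w < N" | "v < N" "w = N" | "v < N" "w < N"
      using 15 by linarith
    then show ?case
    proof cases
      case 1
      then show ?thesis using 15 by auto
    next
      case 2
      then have "?S \<subset> clus w" using 15 by auto
      then show ?thesis using above[of w j] 15 2 j par' p by auto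
    next
      case 3
      then show ?thesis using 15 not_sub[of v] by auto
    next
      case 4
      then show ?thesis using 15 par_least[of v w] par_vert[of v] par' by auto
    qed
  next
    case (16 v d)
    show ?case
    proof (cases "v = N")
      case True
      have "nb d b \<noteq> ?S" if "(d, b) \<in> P" for b using nb_clus[OF that] ne by metis
      then show ?thesis using True lab' lab_fresh[of N d] by auto
    next
      case False
      then show ?thesis using 16 lab[of v d] lab' ne[of v] by auto
    qed
  next
    case (17 v d)
    then show ?case using lab' lab_fresh[of v d] n_less by auto
  qed
qed

end

end

end

locale fitch_input =
  fixes n m :: nat and D :: "nat \<Rightarrow> nat \<Rightarrow> nat \<Rightarrow> bool"
  assumes n2: "2 \<le> n" and m1: "0 < m" and D_irrefl: "\<not> D j j c"
begin

definition nb :: "nat \<Rightarrow> nat \<Rightarrow> nat set" where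
  "nb c j = {x. x < n \<and> \<not> D x j c}"

definition co :: "nat \<Rightarrow> nat \<Rightarrow> nat" where
  "co c j = card {x. x < n \<and> D x j c}"

definition nb_laminar :: bool where
  "nb_laminar \<longleftrightarrow> (\<forall>c<m. \<forall>j<n. \<forall>c'<m. \<forall>j'<n.
     nb c j \<subseteq> nb c' j' \<or> nb c' j' \<subseteq> nb c j \<or> nb c j \<inter> nb c' j' = {})"

definition done_upto :: "nat \<Rightarrow> nat \<Rightarrow> nat \<Rightarrow> (nat \<times> nat) set" where
  "done_upto k c j = {(a, b). a < m \<and> b < n \<and> Suc (co a b) < n \<and>
     (co a b < k \<or> co a b = k \<and> (a < c \<or> a = c \<and> b < j))}"

lemma nb_sub: "nb c j \<subseteq> {..<n}" by (auto simp: nb_def)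

lemma self_nb: "j < n \<Longrightarrow> j \<in> nb c j" by (simp add: nb_def D_irrefl)

lemma card_nb_co: "card (nb c j) + co c j = n"
proof -
  have "card (nb c j \<union> {x. x < n \<and> D x j c}) = card (nb c j) + co c j"
    unfolding co_def nb_def by (rule card_Un_disjoint) auto
  moreover have "nb c j \<union> {x. x < n \<and> D x j c} = {..<n}" by (auto simp: nb_def)
  ultimately show ?thesis by simp
qed

definition main_inv :: "nat \<Rightarrow> (nat \<times> nat) set \<Rightarrow> store \<Rightarrow> bool" where
  "main_inv ok P s \<longleftrightarrow>
     s ''ok'' [] \<le> ok \<and> (nb_laminar \<longrightarrow> s ''ok'' [] = ok) \<and>
     (s ''ok'' [] = 1 \<longrightarrow> (\<exists>clus. cluster_inv n nb P (s ''n_verts'' []) (\<lambda>x. s ''cur'' [x])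
        (\<lambda>v. s ''parent'' [v]) (\<lambda>v. s ''cco'' [v]) (\<lambda>v c. s ''label'' [v, c]) clus))"

lemma main_inv_upd [simp]:
  "a \<notin> {''ok'', ''n_verts'', ''cur'', ''parent'', ''cco'', ''label''} \<Longrightarrow> main_inv ok P (s(a := f)) = main_inv ok P s"
  by (auto simp: main_inv_def)

lemma main_inv_init:
  assumes "s ''ok'' [] = ok" "s ''n_verts'' [] = Suc n" "\<And>x. x < n \<Longrightarrow> s ''cur'' [x] = n"
    "\<And>idx. s ''cco'' idx = 0" "\<And>idx. s ''label'' idx = 0"
  shows "main_inv ok {} s"
proof -
  have "cluster_inv n nb {} (s ''n_verts'' []) (\<lambda>x. s ''cur'' [x])
        (\<lambda>v. s ''parent'' [v]) (\<lambda>v. s ''cco'' [v]) (\<lambda>v c. s ''label'' [v, c]) (\<lambda>_. {..<n})"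
    by unfold_locales (use assms n2 in \<open>auto simp: lessThan_empty_iff\<close>)
  then show ?thesis using assms(1) unfolding main_inv_def by blast
qed

lemma runs_init_prog:
  assumes "s ''n_taxa'' [] = n"
  shows "runs init_prog (2 + (3 + n * (4 + 20))) s
    (\<lambda>s'. s' ''root'' [] = n \<and> s' ''n_verts'' [] = Suc n \<and> (\<forall>x<n. s' ''cur'' [x] = n))"
  unfolding init_prog_def
proof (intro runs_Assign_Seq, goal_cases)
  case 3
  show ?case
  proof (rule runs_For[where N = n and Inv = "\<lambda>k s'. s' ''root'' [] = n \<and> s' ''n_verts'' [] = Suc n \<and>
      (\<forall>x<k. s' ''cur'' [x] = n)"], goal_cases)
    case (7 k s1)
    have "s1 ''n_taxa'' [] = n" using 7(4) assms by auto
    then show ?case using 7(1-3) by (intro runs_loop_free) (auto simp: less_Suc_eq)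
  qed (use assms n2 in auto)
qed (use assms in auto)

lemma runs_same_prog:
  assumes "s ''n_taxa'' [] = n" "s ''j'' [] = j" "s ''c'' [] = c" "j < n" "c < m"
    and "\<And>x. x < n \<Longrightarrow> s ''mark'' [x, j, c] = of_bool (D x j c)"
  shows "runs same_prog (n * (20 + 20)) s
    (\<lambda>s'. s' ''ok'' [] = (if \<forall>x\<in>nb c j. s ''cur'' [x] = s ''p'' [] then s ''ok'' [] else 0))"
  unfolding same_prog_def
proof (rule runs_For[where N = n and Inv = "\<lambda>k s'.
    s' ''ok'' [] = (if \<forall>x<k. x \<in> nb c j \<longrightarrow> s ''cur'' [x] = s ''p'' [] then s ''ok'' [] else 0)"], goal_cases)
  case (7 k s1)
  have "s1 ''j'' [] = j" "s1 ''c'' [] = c" "s1 ''mark'' [k, j, c] = of_bool (D k j c)"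
    "s1 ''cur'' = s ''cur''" "s1 ''p'' [] = s ''p'' []"
    using 7(4) assms 7(1) by auto
  then show ?case using 7(1-3) by (intro runs_loop_free) (auto simp: All_less_Suc nb_def)
next
  case (8 s1)
  then show ?case by (auto simp: nb_def)
qed (use assms n2 in auto)

lemma runs_new_prog:
  assumes "s ''n_taxa'' [] = n" "s ''j'' [] = j" "s ''c'' [] = c" "j < n" "c < m"
    and "\<And>x. x < n \<Longrightarrow> s ''mark'' [x, j, c] = of_bool (D x j c)"
  shows "runs new_prog (3 + (3 + (2 + (3 + n * (11 + 20))))) s
    (\<lambda>s'. s' ''parent'' = (s ''parent'')([s ''n_verts'' []] := s ''p'' []) \<and>
      s' ''cco'' = (s ''cco'')([s ''n_verts'' []] := s ''k'' []) \<and>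
      s' ''p'' [] = s ''n_verts'' [] \<and> s' ''n_verts'' [] = Suc (s ''n_verts'' []) \<and>
      (\<forall>x. s' ''cur'' [x] = (if x \<in> nb c j then s ''n_verts'' [] else s ''cur'' [x])))"
  unfolding new_prog_def
proof (intro runs_Assign_Seq, goal_cases)
  case 5
  let ?s = "com_val (Assign ''n_verts'' [] (Succ (Var ''n_verts'')))
    (com_val (Assign ''p'' [] (Var ''n_verts''))
      (com_val (Assign ''cco'' [Var ''n_verts''] (Var ''k''))
        (com_val (Assign ''parent'' [Var ''n_verts''] (Var ''p'')) s)))"
  have s: "?s ''parent'' = (s ''parent'')([s ''n_verts'' []] := s ''p'' [])"
    "?s ''cco'' = (s ''cco'')([s ''n_verts'' []] := s ''k'' [])"
    "?s ''p'' [] = s ''n_verts'' []" "?s ''n_verts'' [] = Suc (s ''n_verts'' [])"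
    "?s ''cur'' = s ''cur''" "?s ''n_taxa'' = s ''n_taxa''" "?s ''j'' = s ''j''" "?s ''c'' = s ''c''"
    "?s ''mark'' = s ''mark''"
    by simp_all
  show ?case
  proof (rule runs_For[where N = n and Inv = "\<lambda>k s'.
    \<forall>x. s' ''cur'' [x] = (if x < k \<and> x \<in> nb c j then s ''n_verts'' [] else s ''cur'' [x])"], goal_cases)
    case (7 k s1)
    have "s1 ''j'' [] = j" "s1 ''c'' [] = c" "s1 ''mark'' [k, j, c] = of_bool (D k j c)"
      "s1 ''p'' [] = s ''n_verts'' []"
      using 7(4) assms 7(1) s by auto
    then show ?case using 7(1-3) by (intro runs_loop_free) (auto simp: less_Suc_eq nb_def)
  next
    case (8 s1)
    have "s1 ''parent'' = ?s ''parent''" "s1 ''cco'' = ?s ''cco''" "s1 ''p'' = ?s ''p''" "s1 ''n_verts'' = ?s ''n_verts''"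
      using 8(2) by auto
    then show ?case using 8(1) unfolding s by (auto simp: nb_def)
  qed (use assms n2 in auto)
qed auto

lemma main_inv_insert:
  assumes inv: "main_inv ok P s" and ok: "ok \<le> 1" and cj: "c < m" "j < n"
    and P: "\<And>a b. (a, b) \<in> P \<Longrightarrow> a < m \<and> b < n \<and> co a b \<le> co c j"
    and ok': "s' ''ok'' [] = (if \<forall>x\<in>nb c j. s ''cur'' [x] = s ''cur'' [j] then s ''ok'' [] else 0)"
    and old: "s ''cco'' [s ''cur'' [j]] = co c j \<Longrightarrow>
      s' ''n_verts'' [] = s ''n_verts'' [] \<and> s' ''cur'' = s ''cur'' \<and> s' ''parent'' = s ''parent'' \<and>
      s' ''cco'' = s ''cco'' \<and> s' ''label'' = (s ''label'')([s ''cur'' [j], c] := 1)"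
    and new: "s ''cco'' [s ''cur'' [j]] \<noteq> co c j \<Longrightarrow>
      s' ''n_verts'' [] = Suc (s ''n_verts'' []) \<and>
      (\<forall>x. s' ''cur'' [x] = (if x \<in> nb c j then s ''n_verts'' [] else s ''cur'' [x])) \<and>
      s' ''parent'' = (s ''parent'')([s ''n_verts'' []] := s ''cur'' [j]) \<and>
      s' ''cco'' = (s ''cco'')([s ''n_verts'' []] := co c j) \<and>
      s' ''label'' = (s ''label'')([s ''n_verts'' [], c] := 1)"
  shows "main_inv ok (insert (c, j) P) s'"
proof -
  have co: "co c j = n - card (nb c j)" using card_nb_co[of c j] by simp
  have le: "s ''ok'' [] \<le> ok" using inv by (simp add: main_inv_def)
  have "s' ''ok'' [] = ok" if lam: nb_laminar
  proof -
    have sok: "s ''ok'' [] = ok" using inv lam by (simp add: main_inv_def)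
    show ?thesis
    proof (cases "ok = 0")
      case True
      then show ?thesis using ok' sok by simp
    next
      case False
      then have "s ''ok'' [] = 1" using ok sok by simp
      then obtain clus where "cluster_inv n nb P (s ''n_verts'' []) (\<lambda>x. s ''cur'' [x])
          (\<lambda>v. s ''parent'' [v]) (\<lambda>v. s ''cco'' [v]) (\<lambda>v c. s ''label'' [v, c]) clus"
        using inv by (auto simp: main_inv_def)
      then interpret cluster_inv n nb P "s ''n_verts'' []" "\<lambda>x. s ''cur'' [x]"
        "\<lambda>v. s ''parent'' [v]" "\<lambda>v. s ''cco'' [v]" "\<lambda>v c. s ''label'' [v, c]" clus .
      have "s ''cur'' [x] = s ''cur'' [j]" if "x \<in> nb c j" for x
      proof (rule cur_eq_if_laminar[OF nb_sub self_nb[OF cj(2)] _ _ that])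
        fix a b assume ab: "(a, b) \<in> P"
        show "nb a b \<subseteq> nb c j \<or> nb c j \<subseteq> nb a b \<or> nb a b \<inter> nb c j = {}"
          using lam P[OF ab] cj unfolding nb_laminar_def by blast
        show "card (nb c j) \<le> card (nb a b)"
          using P[OF ab] card_nb_co[of a b] card_nb_co[of c j] by linarith
      qed
      then show ?thesis using ok' sok by simp
    qed
  qed
  moreover have "\<exists>clus. cluster_inv n nb (insert (c, j) P) (s' ''n_verts'' []) (\<lambda>x. s' ''cur'' [x])
        (\<lambda>v. s' ''parent'' [v]) (\<lambda>v. s' ''cco'' [v]) (\<lambda>v c. s' ''label'' [v, c]) clus"
    if "s' ''ok'' [] = 1"
  proof -
    have same: "\<And>x. x \<in> nb c j \<Longrightarrow> s ''cur'' [x] = s ''cur'' [j]" and "s ''ok'' [] = 1"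
      using that ok' by (auto split: if_splits)
    then obtain clus where "cluster_inv n nb P (s ''n_verts'' []) (\<lambda>x. s ''cur'' [x])
        (\<lambda>v. s ''parent'' [v]) (\<lambda>v. s ''cco'' [v]) (\<lambda>v c. s ''label'' [v, c]) clus"
      using inv by (auto simp: main_inv_def)
    then interpret cluster_inv n nb P "s ''n_verts'' []" "\<lambda>x. s ''cur'' [x]"
      "\<lambda>v. s ''parent'' [v]" "\<lambda>v. s ''cco'' [v]" "\<lambda>v c. s ''label'' [v, c]" clus .
    show ?thesis
    proof (cases "s ''cco'' [s ''cur'' [j]] = co c j")
      case True
      have "cluster_inv n nb (insert (c, j) P) (s ''n_verts'' []) (\<lambda>x. s ''cur'' [x])
        (\<lambda>v. s ''parent'' [v]) (\<lambda>v. s ''cco'' [v]) (\<lambda>v c. s' ''label'' [v, c]) clus"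
        by (rule insert_old[OF nb_sub self_nb[OF cj(2)] same]) (use True co old in auto)
      then show ?thesis using old[OF True] by auto
    next
      case False
      have "cluster_inv n nb (insert (c, j) P) (Suc (s ''n_verts'' [])) (\<lambda>x. s' ''cur'' [x])
        (\<lambda>v. s' ''parent'' [v]) (\<lambda>v. s' ''cco'' [v]) (\<lambda>v c. s' ''label'' [v, c]) (clus(s ''n_verts'' [] := nb c j))"
        by (rule insert_new[OF nb_sub self_nb[OF cj(2)] same]) (use False co new in auto)
      then show ?thesis using new[OF False] by auto
    qed
  qed
  moreover have "s' ''ok'' [] \<le> ok" using ok' le by simp
  ultimately show ?thesis unfolding main_inv_def by blast
qed

lemma runs_insert_prog:
  assumes s: "s ''n_taxa'' [] = n" "s ''j'' [] = j" "s ''c'' [] = c" "s ''k'' [] = co c j" and cj: "j < n" "c < m"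
    and mark: "\<And>x. x < n \<Longrightarrow> s ''mark'' [x, j, c] = of_bool (D x j c)"
    and inv: "main_inv ok P s" and ok: "ok \<le> 1"
    and P: "\<And>a b. (a, b) \<in> P \<Longrightarrow> a < m \<and> b < n \<and> co a b \<le> co c j"
  shows "runs insert_prog (3 + (n * (20 + 20) + (5 + (3 + (3 + (2 + (3 + n * (11 + 20))))) + 4))) s
    (main_inv ok (insert (c, j) P))"
  unfolding insert_prog_def
proof (rule runs_Assign_Seq, goal_cases)
  case 2
  let ?p = "s ''cur'' [j]"
  let ?s = "com_val (Assign ''p'' [] (Cell ''cur'' [Var ''j''])) s"
  have s0: "?s ''p'' [] = ?p" "\<And>a. a \<noteq> ''p'' \<Longrightarrow> ?s a = s a" using s by auto
  show ?case
  proof (rule runs_Seq, rule runs_mono[OF runs_same_prog[where j = j and c = c] order_refl])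
    fix s1
    assume ok1: "s1 ''ok'' [] = (if \<forall>x\<in>nb c j. ?s ''cur'' [x] = ?s ''p'' [] then ?s ''ok'' [] else 0)"
      and fr: "\<forall>a. a \<notin> assigned same_prog \<longrightarrow> s1 a = ?s a"
    have s1: "s1 ''p'' [] = ?p" "\<And>a. a \<notin> {''p'', ''x'', ''ok''} \<Longrightarrow> s1 a = s a"
      using fr s0 by (auto simp: same_prog_def)
    let ?lab = "Assign ''label'' [Var ''p'', Var ''c''] (Const 1)"
    let ?If = "com.If (Equal (Cell ''cco'' [Var ''p'']) (Var ''k'')) Skip new_prog"
    show "runs (Seq ?If ?lab) (5 + (3 + (3 + (2 + (3 + n * (11 + 20))))) + 4) s1 (main_inv ok (insert (c, j) P))"
    proof (rule runs_Seq)
      have "runs ?If (1 + cond_cost (Equal (Cell ''cco'' [Var ''p'']) (Var ''k'')) + (3 + (3 + (2 + (3 + n * (11 + 20)))))) s1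
        (\<lambda>s2. runs ?lab 4 s2 (main_inv ok (insert (c, j) P)))"
      proof (rule runs_If)
        assume "cond_val s1 (Equal (Cell ''cco'' [Var ''p'']) (Var ''k''))"
        then have eq: "s ''cco'' [?p] = co c j" using s1 s by simp
        show "runs Skip (3 + (3 + (2 + (3 + n * (11 + 20))))) s1
          (\<lambda>s2. runs ?lab 4 s2 (main_inv ok (insert (c, j) P)))"
        proof (intro runs_loop_free)
          show "main_inv ok (insert (c, j) P) (com_val ?lab (com_val Skip s1))"
            by (rule main_inv_insert[OF inv ok cj(2,1) P]) (use ok1 s0 s1 s eq in auto)
        qed auto
      next
        assume "\<not> cond_val s1 (Equal (Cell ''cco'' [Var ''p'']) (Var ''k''))"
        then have neq: "s ''cco'' [?p] \<noteq> co c j" using s1 s by simp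
        show "runs new_prog (3 + (3 + (2 + (3 + n * (11 + 20))))) s1
          (\<lambda>s2. runs ?lab 4 s2 (main_inv ok (insert (c, j) P)))"
        proof (rule runs_mono[OF runs_new_prog[where j = j and c = c] order_refl], goal_cases)
          case (7 s2)
          have s2: "s2 ''ok'' = s1 ''ok''" "s2 ''label'' = s ''label''" "s2 ''c'' = s ''c''"
            using 7(2) s1 by (auto simp: new_prog_def)
          have new: "s2 ''parent'' = (s ''parent'')([s ''n_verts'' []] := ?p)"
            "s2 ''cco'' = (s ''cco'')([s ''n_verts'' []] := co c j)"
            "s2 ''p'' [] = s ''n_verts'' []" "s2 ''n_verts'' [] = Suc (s ''n_verts'' [])"
            "\<forall>x. s2 ''cur'' [x] = (if x \<in> nb c j then s ''n_verts'' [] else s ''cur'' [x])"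
            using 7(1) s1 s by auto
          show ?case
          proof (intro runs_loop_free)
            show "main_inv ok (insert (c, j) P) (com_val ?lab s2)"
              by (rule main_inv_insert[OF inv ok cj(2,1) P]) (use ok1 s0 s2 new s neq in auto)
          qed auto
        qed (use s s1 cj mark in auto)
      qed
      then show "runs ?If (5 + (3 + (3 + (2 + (3 + n * (11 + 20)))))) s1
        (\<lambda>s2. runs ?lab 4 s2 (main_inv ok (insert (c, j) P)))" by simp
    qed
  qed (use s s0 cj mark in auto)
qed auto

lemma done_upto_Suc:
  assumes "c < m" "j < n"
  shows "done_upto k c (Suc j) =
    (if co c j = k \<and> Suc k < n then insert (c, j) (done_upto k c j) else done_upto k c j)"
  using assms by (auto simp: done_upto_def less_Suc_eq)

text \<open>
  A single insertion takes time linear in \<open>n\<close>, so the three nested loops stay within the bound only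
  because each pair \<open>(c, j)\<close> is inserted for exactly one value of the outer counter.
\<close>

lemma runs_main_prog:
  assumes n: "s ''n_taxa'' [] = n" and m: "s ''n_colors'' [] = m"
    and mark: "\<And>x j c. x < n \<Longrightarrow> j < n \<Longrightarrow> c < m \<Longrightarrow> s ''mark'' [x, j, c] = of_bool (D x j c)"
    and co: "\<And>j c. j < n \<Longrightarrow> c < m \<Longrightarrow> s ''co'' [c, j] = co c j"
    and inv: "main_inv ok {} s" and ok: "ok \<le> 1"
  shows "runs main_prog (m * (n * (23 + n * 71)) + n * (m * (n * 40 + 20) + 20)) s
    (main_inv ok {(c, j). c < m \<and> j < n \<and> Suc (co c j) < n})"
proof -
  let ?W = "23 + n * 71"
  let ?Q = "main_inv ok {(c, j). c < m \<and> j < n \<and> Suc (co c j) < n}"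
  let ?t = "\<lambda>k c j. 20 + (if co c j = k then ?W else 0)"
  have "runs main_prog ((\<Sum>k<n. (\<Sum>c<m. (\<Sum>j<n. ?t k c j) + n * 20) + m * 20) + n * 20) s ?Q"
  unfolding main_prog_def
  proof (rule runs_For_sum[where N = n and Inv = "\<lambda>k. main_inv ok (done_upto k 0 0)"], goal_cases)
    case 5
    have "done_upto 0 0 0 = {}" by (auto simp: done_upto_def)
    then show ?case using inv by simp
  next
    case outer: (7 k s1)
    show ?case
    proof (rule runs_For_sum[where N = m and Inv = "\<lambda>c. main_inv ok (done_upto k c 0)"], goal_cases)
      case mid: (7 c s2)
      show ?case
      proof (rule runs_For_sum[where N = n and Inv = "\<lambda>j. main_inv ok (done_upto k c j)"], goal_cases)
        case inner: (7 j s3)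
        have fr: "s3 ''k'' [] = k" "s3 ''c'' [] = c" "s3 ''n_taxa'' [] = n" "s3 ''co'' = s ''co''" "s3 ''mark'' = s ''mark''"
          using inner(4) mid(3,4) outer(3,4) n
          by (simp_all add: insert_prog_def same_prog_def new_prog_def)
        let ?b = "Conj (Equal (Cell ''co'' [Var ''c'', Var ''j'']) (Var ''k'')) (Less (Succ (Var ''k'')) (Var ''n_taxa''))"
        show ?case
        proof (cases "co c j = k \<and> Suc k < n")
          case True
          have *: "done_upto k c (Suc j) = insert (c, j) (done_upto k c j)"
            using done_upto_Suc[OF mid(1) inner(1)] True by simp
          have b: "cond_val s3 ?b" using fr inner(3) co[OF inner(1) mid(1)] True by simp
          have "runs insert_prog (3 + (n * (20 + 20) + (5 + (3 + (3 + (2 + (3 + n * (11 + 20))))) + 4))) s3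
              (main_inv ok (done_upto k c (Suc j)))"
            unfolding *
          proof (rule runs_insert_prog[OF fr(3) inner(3) fr(2) _ inner(1) mid(1) _ inner(2) ok])
            show "s3 ''k'' [] = co c j" using fr True by simp
            show "s3 ''mark'' [x, j, c] = of_bool (D x j c)" if "x < n" for x
              using mark[OF that inner(1) mid(1)] fr by simp
            show "a < m \<and> b < n \<and> co a b \<le> co c j" if "(a, b) \<in> done_upto k c j" for a b
              using that True by (auto simp: done_upto_def)
          qed
          then have "runs (com.If ?b insert_prog Skip) (1 + cond_cost ?b + (23 + n * 71)) s3
              (main_inv ok (done_upto k c (Suc j)))"
            using b by (intro runs_If) (auto elim: runs_mono)
          then show ?thesis by (rule runs_mono) (use True in simp_all)
        next
          case False
          then have "done_upto k c (Suc j) = done_upto k c j"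
            using done_upto_Suc[OF mid(1) inner(1)] by auto
          moreover have "\<not> cond_val s3 ?b" using fr inner(3) co[OF inner(1) mid(1)] False by auto
          ultimately have "runs (com.If ?b insert_prog Skip) (1 + cond_cost ?b + 1) s3
              (main_inv ok (done_upto k c (Suc j)))"
            using inner(2) by (intro runs_If runs_loop_free) auto
          then show ?thesis by (rule runs_mono) simp_all
        qed
      next
        case (8 s3)
        have "done_upto k c n = done_upto k (Suc c) 0" by (auto simp: done_upto_def less_Suc_eq)
        then show ?case using 8 by simp
      next
        case (6 j s3)
        then show ?case using mid(4) outer(4) n by (simp add: insert_prog_def same_prog_def new_prog_def)
      qed (use mid(2) n2 in \<open>auto simp: insert_prog_def same_prog_def new_prog_def\<close>)
    next
      case (8 s3)
      have "done_upto k m 0 = done_upto (Suc k) 0 0" by (auto simp: done_upto_def less_Suc_eq)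
      then show ?case using 8 by simp
    next
      case (6 j s3)
      then show ?case using outer(4) m by (simp add: insert_prog_def same_prog_def new_prog_def)
    qed (use outer(2) m1 in \<open>auto simp: insert_prog_def same_prog_def new_prog_def\<close>)
  next
    case (8 s1)
    have "done_upto n 0 0 = {(c, j). c < m \<and> j < n \<and> Suc (co c j) < n}" by (auto simp: done_upto_def)
    then show ?case using 8 by simp
  next
    case (6 j s1)
    then show ?case using n by (simp add: insert_prog_def same_prog_def new_prog_def)
  qed (use n2 in \<open>auto simp: insert_prog_def same_prog_def new_prog_def\<close>)
  then show ?thesis
  proof (rule runs_mono)
    have "(\<Sum>k<n. \<Sum>c<m. \<Sum>j<n. if co c j = k then ?W else 0) =
        (\<Sum>c<m. \<Sum>j<n. \<Sum>k<n. if co c j = k then ?W else 0)"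
      by (subst sum.swap) (intro sum.cong refl sum.swap)
    also have "\<dots> \<le> (\<Sum>c<m. \<Sum>j<n. ?W)"
      by (intro sum_mono) simp
    also have "\<dots> = m * (n * ?W)" by simp
    finally show "(\<Sum>k<n. (\<Sum>c<m. (\<Sum>j<n. ?t k c j) + n * 20) + m * 20) + n * 20
        \<le> m * (n * ?W) + n * (m * (n * 40 + 20) + 20)"
      by (simp add: sum.distrib algebra_simps)
  qed
qed

lemma runs_leaf_prog:
  assumes n: "s ''n_taxa'' [] = n" and m: "s ''n_colors'' [] = m"
    and co: "\<And>j c. j < n \<Longrightarrow> c < m \<Longrightarrow> s ''co'' [c, j] = co c j"
  shows "runs leaf_prog (n * (4 + m * (20 + 20) + 20)) s
    (\<lambda>s'. (\<forall>v. s' ''parent'' [v] = (if v < n then s ''cur'' [v] else s ''parent'' [v])) \<and>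
      (\<forall>v c. s' ''label'' [v, c] = (if v < n \<and> c < m \<and> Suc (co c v) = n then 1 else s ''label'' [v, c])))"
  unfolding leaf_prog_def
proof (rule runs_For[where N = n and Inv = "\<lambda>k s'.
    (\<forall>v. s' ''parent'' [v] = (if v < k then s ''cur'' [v] else s ''parent'' [v])) \<and>
      (\<forall>v c. s' ''label'' [v, c] = (if v < k \<and> c < m \<and> Suc (co c v) = n then 1 else s ''label'' [v, c]))"], goal_cases)
  case outer: (7 j s1)
  show ?case
  proof (rule runs_Assign_Seq, goal_cases)
    case 2
    let ?s = "com_val (Assign ''parent'' [Var ''j''] (Cell ''cur'' [Var ''j''])) s1"
    have cur: "s1 ''cur'' = s ''cur''" using outer(4) by simp
    have s0: "?s ''parent'' = (s1 ''parent'')([j] := s ''cur'' [j])" "\<And>a. a \<noteq> ''parent'' \<Longrightarrow> ?s a = s1 a"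
      using outer(3) cur by auto
    have fr0: "?s ''n_colors'' = s ''n_colors''" "?s ''n_taxa'' = s ''n_taxa''" "?s ''co'' = s ''co''" "?s ''j'' [] = j"
      using outer(3,4) by simp_all
    show ?case
    proof (rule runs_For[where N = m and Inv = "\<lambda>k s'. \<forall>v c. s' ''label'' [v, c] =
        (if (v < j \<and> c < m \<or> v = j \<and> c < k) \<and> Suc (co c v) = n then 1 else s ''label'' [v, c])"], goal_cases)
      case inner: (7 c s2)
      have "s2 ''j'' [] = j" "s2 ''n_taxa'' [] = n" "s2 ''co'' [c, j] = co c j"
        using inner(1,4) fr0 co outer(1) n by simp_all
      then show ?case using inner(1-3) by (intro runs_loop_free) (auto simp: less_Suc_eq)
    next
      case 5
      then show ?case using outer(2) s0 by auto
    next
      case (6 k s2)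
      then show ?case using fr0 m by simp
    next
      case (8 s2)
      have "s2 ''parent'' = ?s ''parent''" using 8(2) by simp
      then show ?case using 8(1) outer(2) s0(1) by (auto simp: less_Suc_eq)
    qed (use m1 in auto)
  qed auto
qed (use n n2 in auto)

definition nb_nested :: bool where
  "nb_nested \<longleftrightarrow> (\<forall>c<m. \<forall>j<n. \<forall>x<n. \<not> D x j c \<longrightarrow> co c j \<le> co c x)"

definition tree_found :: "store \<Rightarrow> bool" where
  "tree_found s \<longleftrightarrow> nb_nested \<and> s ''root'' [] = n \<and>
    (\<exists>cur par cco lab clus.
      cluster_inv n nb {(c, j). c < m \<and> j < n \<and> Suc (co c j) < n} (s ''n_verts'' []) cur par cco lab clus \<and>
      (\<forall>v. s ''parent'' [v] = (if v < n then cur v else par v)) \<and>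
      (\<forall>v c. s ''label'' [v, c] = (if v < n \<and> c < m \<and> Suc (co c v) = n then 1 else lab v c)))"

lemma least_resolved_if_tree_found:
  assumes xs: "distinct xs" "n = length xs" and ms: "distinct ms" "m = length ms"
    and nb_eq: "\<And>c j. c < m \<Longrightarrow> j < n \<Longrightarrow> nbh_idx xs ms \<epsilon> c j = nb c j"
    and found: "tree_found s"
  shows "least_resolved (set xs) (set ms) \<epsilon> (output_tree xs ms s)"
proof -
  let ?P = "{(c, j). c < m \<and> j < n \<and> Suc (co c j) < n}"
  obtain cur par cco lab clus where
    inv: "cluster_inv n nb ?P (s ''n_verts'' []) cur par cco lab clus"
    and par': "\<And>v. s ''parent'' [v] = (if v < n then cur v else par v)"
    and lab': "\<And>v c. s ''label'' [v, c] = (if v < n \<and> c < m \<and> Suc (co c v) = n then 1 else lab v c)"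
    and nested: nb_nested and root: "s ''root'' [] = n"
    using found unfolding tree_found_def by blast
  let ?N = "s ''n_verts'' []"
  interpret I: cluster_inv n nb ?P ?N cur par cco lab clus by (rule inv)
  define C where "C v = (if v < n then {v} else clus v)" for v
  have single: "Suc (co c j) = n \<longleftrightarrow> nb c j = {j}" if "j < n" for c j
  proof
    assume "Suc (co c j) = n"
    then have "card (nb c j) = 1" using card_nb_co[of c j] by linarith
    then show "nb c j = {j}" using self_nb[OF that, of c] by (auto simp: card_1_singleton_iff)
  next
    assume "nb c j = {j}"
    then show "Suc (co c j) = n" using card_nb_co[of c j] by simp
  qed
  have inP: "(c, j) \<in> ?P" if "c < m" "j < n" "nb c j \<noteq> {j}" for c j
  proof -
    have "co c j < n" using card_nb_co[of c j] self_nb[OF that(2), of c] nb_sub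
      by (metis add_cancel_left_left card_0_eq empty_iff finite_lessThan finite_subset le_add2 le_neq_implies_less)
    then show ?thesis using that single[of j c] by auto
  qed
  have big: "clus v \<noteq> {x}" if v: "n \<le> v" "v < ?N" for v x
  proof (cases "v = n")
    case True
    then show ?thesis using I.clus_root n2 by (metis card_lessThan is_singletonI is_singleton_altdef numeral_le_one_iff semiring_norm(69))
  next
    case False
    then obtain c j where cj: "c < m" "j < n" "Suc (co c j) < n" "clus v = nb c j"
      using I.clus_nb[of v] v by auto
    have "nb c j \<noteq> {x}" using single[OF cj(2), of c] cj(3) self_nb[OF cj(2), of c] by auto
    then show ?thesis using cj by simp
  qed
  have lam: "nb c i \<subseteq> nb c j" if c: "c < m" and j: "j < n" and i: "i \<in> nb c j" for c i j
  proof -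
    have i': "i < n" "\<not> D i j c" using i by (auto simp: nb_def)
    consider "nb c i = {i}" | "nb c j = {j}" | "(c, i) \<in> ?P" "(c, j) \<in> ?P" using inP c j i'(1) by blast
    then show ?thesis
    proof cases
      case 3
      obtain v w where v: "n \<le> v" "v < ?N" "clus v = nb c i" and w: "n \<le> w" "w < ?N" "clus w = nb c j"
        using I.nb_clus[OF 3(1)] I.nb_clus[OF 3(2)] by blast
      have "i \<in> nb c i \<inter> nb c j" using i self_nb[OF i'(1)] by blast
      then consider "nb c i \<subseteq> nb c j" | "nb c j \<subseteq> nb c i" using I.laminar[OF v(1,2) w(1,2)] v(3) w(3) by auto
      then show ?thesis
      proof cases
        case 2
        have "co c j \<le> co c i" using nested c j i' unfolding nb_nested_def by blast
        then have "card (nb c i) \<le> card (nb c j)" using card_nb_co[of c i] card_nb_co[of c j] by linarith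
        then show ?thesis using 2 nb_sub by (metis card_seteq finite_lessThan finite_subset order_refl)
      qed
    qed (use i i' self_nb in auto)
  qed
  have verts: "v < n \<or> n \<le> v" for v :: nat by linarith
  have "cluster_store xs ms \<epsilon> s C"
  proof (unfold_locales, unfold xs(2)[symmetric] ms(2)[symmetric], goal_cases)
    case 1
    then show ?case using xs by simp
  next
    case 2
    then show ?case using root by simp
  next
    case 3
    then show ?case using I.n_less by simp
  next
    case (4 i)
    then show ?case by (simp add: C_def)
  next
    case 5
    then show ?case using I.clus_root by (simp add: C_def)
  next
    case (6 v)
    then show ?case using I.clus_sub[of v] by (auto simp: C_def)
  next
    case (7 v)
    then show ?case using I.clus_ne[of v] by (auto simp: C_def)
  next
    case 8
    show ?case
    proof (rule inj_onI)
      fix v w assume vw: "v \<in> {..<?N}" "w \<in> {..<?N}" "C v = C w"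
      then show "v = w"
        using big[of v w] big[of w v] I.clus_inj[of v w] verts[of v] verts[of w] by (auto simp: C_def split: if_splits)
    qed
  next
    case (9 v)
    then show ?case using I.cur_vert[of v] I.par_vert[of v] par' by auto
  next
    case (10 v)
    show ?case
    proof (cases "v < n")
      case True
      then have "{v} \<subset> clus (cur v)" using I.cur_mem[OF True] big[of "cur v" v] I.cur_vert[OF True] by auto
      then show ?thesis using True I.cur_vert[OF True] par' by (simp add: C_def)
    next
      case False
      then have "n < v" using 10 by simp
      then show ?thesis using I.par_clus[of v] I.par_vert[of v] 10 par' by (simp add: C_def)
    qed
  next
    case (11 v w)
    show ?case
    proof (cases "v < n")
      case True
      then have "n \<le> w" "v \<in> clus w" using 11 by (auto simp: C_def split: if_splits)
      then show ?thesis using I.cur_least[of v w] I.cur_vert[OF True] True par' 11 by (simp add: C_def)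
    next
      case False
      then have v: "n < v" using 11 by simp
      then have "n \<le> w" using 11(4) I.clus_ne[of v] 11(1) by (auto simp: C_def split: if_splits)
      then show ?thesis using I.par_least[of v w] I.par_vert[of v] v par' 11 by (simp add: C_def)
    qed
  next
    case (12 c i j)
    have "i < n" using 12 nb_eq nb_sub by blast
    then show ?case using lam 12 nb_eq by simp
  next
    case (13 c j)
    show ?case
    proof (cases "nb c j = {j}")
      case True
      then show ?thesis using 13 nb_eq I.n_less by (intro exI[of _ j]) (simp add: C_def)
    next
      case False
      then obtain v where "n \<le> v" "v < ?N" "clus v = nb c j" using I.nb_clus inP 13 by blast
      then show ?thesis using 13 nb_eq by (intro exI[of _ v]) (simp add: C_def)
    qed
  next
    case (14 v)
    then obtain c j where "c < m" "j < n" "clus v = nb c j" using I.clus_nb[of v] by auto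
    then show ?case using 14 nb_eq by (intro exI[of _ c] conjI exI[of _ j]) (auto simp: C_def)
  next
    case (15 v c)
    have eq: "(\<exists>j<n. C v = nbh_idx xs ms \<epsilon> c j) \<longleftrightarrow> (\<exists>j<n. C v = nb c j)" using nb_eq 15 by auto
    show ?case
    proof (cases "v < n")
      case True
      have "(\<exists>j<n. {v} = nb c j) \<longleftrightarrow> Suc (co c v) = n"
      proof
        assume "\<exists>j<n. {v} = nb c j"
        then obtain j where j: "j < n" "{v} = nb c j" by blast
        then have "j = v" using self_nb[of j c] by auto
        then show "Suc (co c v) = n" using single j by auto
      qed (use single[OF True, of c] True in auto)
      then show ?thesis unfolding eq using True 15 lab' I.lab_fresh[of v c] by (simp add: C_def)
    next
      case False
      have "(\<exists>j. (c, j) \<in> ?P \<and> clus v = nb c j) \<longleftrightarrow> (\<exists>j<n. clus v = nb c j)"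
      proof
        assume "\<exists>j<n. clus v = nb c j"
        then obtain j where j: "j < n" "clus v = nb c j" by blast
        then have "nb c j \<noteq> {j}" using big[of v j] False 15 by auto
        then show "\<exists>j. (c, j) \<in> ?P \<and> clus v = nb c j" using inP[of c j] j 15 by blast
      qed auto
      then show ?thesis unfolding eq using False 15 lab' I.lab[of v c] by (simp add: C_def)
    qed
  qed
  then show ?thesis using ms(1) by (rule cluster_store.least_resolved_output)
qed

lemma nb_laminar_nested_if_fitch:
  assumes xs: "n = length xs" and ms: "m = length ms"
    and nb_eq: "\<And>c j. c < m \<Longrightarrow> j < n \<Longrightarrow> nbh_idx xs ms \<epsilon> c j = nb c j"
    and fitch: "fitch_map (set xs) (set ms) \<epsilon>"
  shows "nb_laminar" "nb_nested"
proof -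
  obtain T where "edge_labeled_tree (set xs) (set ms) T" "explains (set xs) (set ms) T \<epsilon>"
    using fitch unfolding fitch_map_def by blast
  then interpret explaining_tree T "set xs" "set ms" \<epsilon> by (rule explaining_treeI)
  let ?S = "\<lambda>c j. nbh (set xs) \<epsilon> (ms ! c) (xs ! j)"
  have nb: "nb c j = {i. i < n \<and> xs ! i \<in> ?S c j}" if "c < m" "j < n" for c j
    using nb_eq[OF that] xs by (simp add: nbh_idx_def)
  have mem: "xs ! j \<in> set xs" "ms ! c \<in> set ms" if "c < m" "j < n" for c j
    using that xs ms by auto
  show nb_laminar
    unfolding nb_laminar_def
  proof (intro allI impI)
    fix c j c' j' assume cj: "c < m" "j < n" "c' < m" "j' < n"
    have "?S c j \<subseteq> ?S c' j' \<or> ?S c' j' \<subseteq> ?S c j \<or> ?S c j \<inter> ?S c' j' = {}"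
      using nbh_laminar mem cj by metis
    then show "nb c j \<subseteq> nb c' j' \<or> nb c' j' \<subseteq> nb c j \<or> nb c j \<inter> nb c' j' = {}"
      unfolding nb[OF cj(1,2)] nb[OF cj(3,4)] by blast
  qed
  show nb_nested
    unfolding nb_nested_def
  proof (intro allI impI)
    fix c j x assume cj: "c < m" "j < n" "x < n" "\<not> D x j c"
    then have "x \<in> nb c j" by (simp add: nb_def)
    then have "xs ! x \<in> ?S c j" using nb cj by simp
    then have "?S c x \<subseteq> ?S c j" using nbh_subset mem cj by metis
    then have "nb c x \<subseteq> nb c j" unfolding nb[OF cj(1,2)] nb[OF cj(1,3)] by blast
    then have "card (nb c x) \<le> card (nb c j)" using nb_sub by (meson card_mono finite_lessThan finite_subset)
    then show "co c j \<le> co c x" using card_nb_co[of c x] card_nb_co[of c j] by linarith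
  qed
qed

lemma runs_fitch_prog:
  fixes L :: "nat \<Rightarrow> nat \<Rightarrow> nat list"
  assumes n: "s ''n_taxa'' [] = n" and m: "s ''n_colors'' [] = m"
    and size: "\<And>i j. i < n \<Longrightarrow> j < n \<Longrightarrow> s ''size'' [i, j] = length (L i j)"
    and len: "\<And>i j. length (L i j) \<le> m"
    and color: "\<And>i j l. i < n \<Longrightarrow> j < n \<Longrightarrow> l < length (L i j) \<Longrightarrow> s ''color'' [i, j, l] = L i j ! l"
    and L: "\<And>i j c. i < n \<Longrightarrow> j < n \<Longrightarrow> c \<in> set (L i j) \<longleftrightarrow> D i j c"
    and zero: "\<And>a idx. a \<in> {''mark'', ''co'', ''cco'', ''label''} \<Longrightarrow> s a idx = 0"
  shows "runs fitch_prog (500 * (n\<^sup>2 * m)) s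
    (\<lambda>s'. s' ''is_fitch'' [] \<le> 1 \<and> (nb_laminar \<and> nb_nested \<longrightarrow> s' ''is_fitch'' [] = 1) \<and>
      (s' ''is_fitch'' [] = 1 \<longrightarrow> tree_found s'))" (is "runs _ _ _ ?Q")
proof -
  let ?P = "{(c, j). c < m \<and> j < n \<and> Suc (co c j) < n}"
  let ?t1 = "n * (n * (m * (8 + 20) + 20) + 20)" and ?t2 = "m * (n * (n * (15 + 20) + 20) + 20)"
    and ?t3 = "2 + m * (n * (n * (17 + 20) + 20) + 20)" and ?t4 = "2 + (3 + n * (4 + 20))"
    and ?t5 = "m * (n * (23 + n * 71)) + n * (m * (n * 40 + 20) + 20)" and ?t6 = "n * (4 + m * (20 + 20) + 20)"
  have pos: "0 < n" "0 < m" using n2 m1 by auto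
  let ?fin = "Assign ''is_fitch'' [] (Var ''ok'')"
  let ?body = "Seq mark_prog (Seq count_prog (Seq check_prog (Seq init_prog (Seq main_prog (Seq leaf_prog ?fin)))))"
  have "runs ?body (?t1 + (?t2 + (?t3 + (?t4 + (?t5 + (?t6 + 2)))))) s ?Q"
  proof (rule runs_Seq, rule runs_mono[OF runs_mark_prog[where L = L] order_refl], goal_cases)
    case (8 s1)
    have mark1: "s1 ''mark'' [x, j, c] = of_bool (D x j c)" if "x < n" "j < n" for x j c
      using 8(1) L that by simp
    have fr1: "s1 a = s a" if "a \<notin> {''i'', ''j'', ''l'', ''mark''}" for a
      using 8(2) that by (auto simp: mark_prog_def)
    show ?case
    proof (rule runs_Seq, rule runs_mono[OF runs_count_prog[where D = D] order_refl], goal_cases)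
      case (7 s2)
      have co2: "s2 ''co'' [c, j] = co c j" if "j < n" "c < m" for j c
        using 7(1) that by (simp add: co_def)
      have fr2: "s2 a = s1 a" if "a \<notin> {''c'', ''j'', ''x'', ''co''}" for a
        using 7(2) that by (auto simp: count_prog_def)
      show ?case
      proof (rule runs_Seq, rule runs_mono[OF runs_check_prog[where D = D and co = co] order_refl], goal_cases)
        case (7 s3)
        have ok3: "s3 ''ok'' [] = of_bool nb_nested" using 7(1) by (simp add: nb_nested_def)
        have fr3: "s3 a = s2 a" if "a \<notin> {''c'', ''j'', ''x'', ''ok''}" for a
          using 7(2) that by (auto simp: check_prog_def)
        show ?case
        proof (rule runs_Seq, rule runs_mono[OF runs_init_prog order_refl], goal_cases)
          case (2 s4)
          have fr4: "s4 a = s3 a" if "a \<notin> {''x'', ''root'', ''n_verts'', ''cur''}" for a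
            using 2(2) that by (auto simp: init_prog_def)
          have old4: "s4 ''n_taxa'' [] = n" "s4 ''n_colors'' [] = m" "s4 ''mark'' = s1 ''mark''" "s4 ''co'' = s2 ''co''"
            "s4 ''ok'' [] = of_bool nb_nested" "s4 ''cco'' = s ''cco''" "s4 ''label'' = s ''label''"
            using n m ok3 by (simp_all add: fr4 fr3 fr2 fr1)
          have "main_inv (of_bool nb_nested) {} s4"
            by (rule main_inv_init) (use 2(1) old4 zero in auto)
          note main = runs_main_prog[OF old4(1,2) _ _ this]
          show ?case
          proof (rule runs_Seq, rule runs_mono[OF main order_refl], goal_cases)
            case (4 s5)
            have fr5: "s5 a = s4 a"
              if "a \<notin> {''k'', ''c'', ''j'', ''x'', ''p'', ''ok'', ''cur'', ''n_verts'', ''parent'', ''cco'', ''label''}" for a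
              using 4(2) that by (auto simp: main_prog_def insert_prog_def same_prog_def new_prog_def)
            have old5: "s5 ''n_taxa'' [] = n" "s5 ''n_colors'' [] = m" "s5 ''co'' = s2 ''co''" "s5 ''root'' [] = n"
              using old4 2(1) by (simp_all add: fr5)
            show ?case
            proof (rule runs_Seq, rule runs_mono[OF runs_leaf_prog order_refl], goal_cases)
              case (4 s6)
              have fr6: "s6 a = s5 a" if "a \<notin> {''c'', ''j'', ''parent'', ''label''}" for a
                using 4(2) that by (auto simp: leaf_prog_def)
              let ?s = "com_val ?fin s6"
              have s: "?s ''is_fitch'' [] = s5 ''ok'' []" "?s ''root'' [] = n" "?s ''n_verts'' = s5 ''n_verts''"
                "?s ''parent'' = s6 ''parent''" "?s ''label'' = s6 ''label''"
                using old5 by (simp_all add: fr6)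
              have inv: "main_inv (of_bool nb_nested) ?P s5" by fact
              have "tree_found ?s" if ok5: "s5 ''ok'' [] = 1"
              proof -
                have nb_nested using inv ok5 by (cases nb_nested) (auto simp: main_inv_def)
                moreover obtain clus where "cluster_inv n nb ?P (s5 ''n_verts'' []) (\<lambda>x. s5 ''cur'' [x])
                    (\<lambda>v. s5 ''parent'' [v]) (\<lambda>v. s5 ''cco'' [v]) (\<lambda>v c. s5 ''label'' [v, c]) clus"
                  using inv ok5 unfolding main_inv_def by blast
                ultimately show ?thesis
                  using conjunct1[OF 4(1)] conjunct2[OF 4(1)] s(2) unfolding tree_found_def s(3-5) by (intro conjI exI) assumption+
              qed
              moreover have "s5 ''ok'' [] \<le> 1" "nb_laminar \<and> nb_nested \<longrightarrow> s5 ''ok'' [] = 1"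
                using inv by (auto simp: main_inv_def of_bool_def split: if_splits)
              ultimately have "?Q ?s" using s(1) by simp
              then show ?case by (intro runs_loop_free) auto
            qed (use old5 co2 in auto)
          qed (use old4 mark1 co2 in auto)
        qed (use n fr1 fr2 fr3 in auto)
      qed (use n m pos mark1 co2 fr1 fr2 in auto)
    qed (use n m pos mark1 zero fr1 in auto)
  qed (use n pos size len color zero in auto)
  then have "runs fitch_prog (1 + cond_cost (Less (Const 1) (Var ''n_taxa'')) + (?t1 + (?t2 + (?t3 + (?t4 + (?t5 + (?t6 + 2))))))) s ?Q"
    unfolding fitch_prog_def by (intro runs_If) (use n n2 in auto)
  then show ?thesis
  proof (rule runs_mono)
    have "1 \<le> n" "1 \<le> m" using pos by auto
    then have le: "n \<le> n * n * m" "n * m \<le> n * n * m" "m \<le> n * n * m" "n * n \<le> n * n * m" "1 \<le> n * n * m"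
      by auto
    show "1 + cond_cost (Less (Const 1) (Var ''n_taxa'')) + (?t1 + (?t2 + (?t3 + (?t4 + (?t5 + (?t6 + 2)))))) \<le> 500 * (n\<^sup>2 * m)"
      (is "?t \<le> _")
    proof -
      have "?t = 13 + 40 * m + 20 * (n * n) + 88 * n + 123 * (n * m) + 211 * (n * n * m)"
        by (simp add: algebra_simps)
      also have "\<dots> \<le> 500 * (n * n * m)" using le by linarith
      finally show ?thesis by (simp add: power2_eq_square)
    qed
  qed
qed

end

lemma not_fitch_map_singleton: "\<not> fitch_map {x} M \<epsilon>"
proof
  assume "fitch_map {x} M \<epsilon>"
  then obtain T where "edge_labeled_tree {x} M T" "explains {x} M T \<epsilon>"
    unfolding fitch_map_def by blast
  then interpret explaining_tree T "{x}" M \<epsilon> by (rule explaining_treeI)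
  have "cluster T (troot T) = cluster T (Leaf x)" using cluster_root cluster_leaf by simp
  then have "troot T = Leaf x" using cluster_inj root_vert leaf_vert by simp
  moreover have "Leaf x \<in> tleaves T" using leaves_eq by simp
  ultimately show False by (simp add: tleaves_def)
qed

lemma fitch_prog_correct:
  fixes xs :: "'x list" and ms :: "'c list" and \<epsilon> :: "'x \<times> 'x \<Rightarrow> 'c set"
  assumes xs: "distinct xs" "xs \<noteq> []" and ms: "distinct ms" "ms \<noteq> []"
  shows "runs fitch_prog (500 * ((length xs)\<^sup>2 * length ms)) (input_store xs ms \<epsilon>)
    (\<lambda>s. s ''is_fitch'' [] = (if fitch_map (set xs) (set ms) \<epsilon> then 1 else 0) \<and>
      (fitch_map (set xs) (set ms) \<epsilon> \<longrightarrow> least_resolved (set xs) (set ms) \<epsilon> (output_tree xs ms s)))"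
proof (cases "length xs = 1")
  case True
  then obtain x where x: "xs = [x]" by (auto simp: length_Suc_conv)
  have "runs fitch_prog (1 + cond_cost (Less (Const 1) (Var ''n_taxa'')) + 1) (input_store xs ms \<epsilon>)
    (\<lambda>s. s ''is_fitch'' [] = 0)"
    unfolding fitch_prog_def by (intro runs_If runs_loop_free) (auto simp: x input_store_def)
  moreover have "1 \<le> length ms" using ms(2) by (simp add: Suc_le_eq)
  ultimately show ?thesis
    by (elim runs_mono) (use not_fitch_map_singleton[of x "set ms" \<epsilon>] in \<open>auto simp: x\<close>)
next
  case False
  define n where "n = length xs"
  define m where "m = length ms"
  define L where "L i j = (if i < n \<and> j < n \<and> i \<noteq> j then ordered_colors xs ms \<epsilon> i j else [])" for i j
  define D where "D i j c \<longleftrightarrow> c \<in> set (L i j)" for i j c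
  have "2 \<le> n" using False xs(2) by (cases xs; cases "tl xs") (auto simp: n_def)
  interpret fitch_input n m D
    by unfold_locales (use \<open>2 \<le> n\<close> ms in \<open>auto simp: m_def D_def L_def\<close>)
  have nb_eq: "nbh_idx xs ms \<epsilon> c j = nb c j" if "c < m" "j < n" for c j
    using that xs(1) unfolding nb_def
    by (auto simp: nbh_idx_def nbh_def D_def L_def ordered_colors_def n_def m_def nth_eq_iff_index_eq)
  let ?s = "input_store xs ms \<epsilon>"
  have "runs fitch_prog (500 * (n\<^sup>2 * m)) ?s
    (\<lambda>s'. s' ''is_fitch'' [] \<le> 1 \<and> (nb_laminar \<and> nb_nested \<longrightarrow> s' ''is_fitch'' [] = 1) \<and>
      (s' ''is_fitch'' [] = 1 \<longrightarrow> tree_found s'))"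
  proof (rule runs_fitch_prog[where L = L], goal_cases)
    case (4 i j)
    have "length (ordered_colors xs ms \<epsilon> i j) \<le> length ms"
      unfolding ordered_colors_def by (rule order_trans[OF length_filter_le]) simp
    then show ?case by (simp add: L_def m_def)
  next
    case (7 a idx)
    then show ?case by (auto simp: input_store_def split: list.split)
  qed (auto simp: input_store_def L_def D_def n_def m_def)
  then show ?thesis
    unfolding n_def[symmetric] m_def[symmetric]
  proof (rule runs_mono, goal_cases)
    case (2 s')
    have "fitch_map (set xs) (set ms) \<epsilon> \<Longrightarrow> s' ''is_fitch'' [] = 1"
      using nb_laminar_nested_if_fitch[OF n_def m_def nb_eq] 2(1) by blast
    moreover have lr: "least_resolved (set xs) (set ms) \<epsilon> (output_tree xs ms s')" if "s' ''is_fitch'' [] = 1"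
      using least_resolved_if_tree_found[OF xs(1) n_def ms(1) m_def nb_eq] 2(1) that by blast
    then have "fitch_map (set xs) (set ms) \<epsilon>" if "s' ''is_fitch'' [] = 1"
      using that unfolding least_resolved_def fitch_map_def by blast
    ultimately show ?case using lr 2(1) by (auto simp: le_Suc_eq)
  qed simp
qed

theorem theorem6:
  "\<exists>(P :: com) (C :: nat).
     \<forall>(X :: 'x set) (M :: 'c set) (\<epsilon> :: 'x \<times> 'x \<Rightarrow> 'c set) (xs :: 'x list) (ms :: 'c list).
       finite X \<and> X \<noteq> {} \<and> finite M \<and> M \<noteq> {} \<and>
       (\<forall>x \<in> X. \<forall>y \<in> X. x \<noteq> y \<longrightarrow> \<epsilon> (x, y) \<subseteq> M) \<and>
       distinct xs \<and> set xs = X \<and> distinct ms \<and> set ms = M \<longrightarrow>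
       (\<exists>t s. exec P (input_store xs ms \<epsilon>) t s \<and>
              t \<le> C * ((card X)\<^sup>2 * card M) \<and>
              s ''is_fitch'' [] = (if fitch_map X M \<epsilon> then 1 else 0) \<and>
              (fitch_map X M \<epsilon> \<longrightarrow> least_resolved X M \<epsilon> (output_tree xs ms s)))"
proof (rule exI[of _ fitch_prog], rule exI[of _ 500], intro allI impI, elim conjE)
  fix X :: "'x set" and M :: "'c set" and \<epsilon> :: "'x \<times> 'x \<Rightarrow> 'c set" and xs :: "'x list" and ms :: "'c list"
  assume "X \<noteq> {}" "M \<noteq> {}" and xs: "distinct xs" "set xs = X" and ms: "distinct ms" "set ms = M"
  then have "xs \<noteq> []" "ms \<noteq> []" by auto
  note fitch_prog_correct[OF xs(1) this(1) ms(1) this(2), of \<epsilon>]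
  moreover have "length xs = card X" "length ms = card M"
    using distinct_card xs ms by fastforce+
  ultimately show "\<exists>t s. exec fitch_prog (input_store xs ms \<epsilon>) t s \<and>
              t \<le> 500 * ((card X)\<^sup>2 * card M) \<and>
              s ''is_fitch'' [] = (if fitch_map X M \<epsilon> then 1 else 0) \<and>
              (fitch_map X M \<epsilon> \<longrightarrow> least_resolved X M \<epsilon> (output_tree xs ms s))"
    unfolding runs_def xs(2) ms(2) by metis
qed

end
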